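(* There exist constants $C>0$ and $p\in(0,1)$, not depending on $k$ and $\mu$, such that the following holds for every integer $k\ge 0$. (Direct part.) Let $\mu$ be a locally finite measure on $\mathbb{D}$ such that the quantity $$\tau_k(\mu)=\sup_{z\in\mathbb{D}}\left\{|\mu|\left(\mathbf{D}(z,\tfrac12(1-|z|))\right)(1-|z|)^{-2(k+1)}\right\}$$ is finite. Then for every $f\in\mathcal{A}^2(\mathbb{D})$ $$\left|\int_{\mathbb{D}}|f^{(k)}|^2\,d\mu\right|\le C_k(\mu)\,\|f\|^2_{\mathcal{A}^2}\quad\text{with the constant}\quad C_k(\mu)=C\,p^{-2k}(k!)^2\,\tau_k(\mu).$$ (Converse part.) If $\mu$ is a positive measure on $\mathbb{D}$ for which there is a finite constant $C'$ with $\left|\int_{\mathbb{D}}|f^{(k)}|^2\,d\mu\right|\le C'\|f\|^2_{\mathcal{A}^2}$ for all $f\in\mathcal{A}^2(\mathbb{D})$, then $\tau_k(\mu)<\infty$, and the smallest such constant $C'=C_k(\mu)$ satisfies $C_k(\mu)\le C\,p^{-2k}(k!)^2\,\tau_k(\mu)$.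
   Context: $\mathbb{D}$ is the open unit disk in $\mathbb{C}$, and $\mathcal{A}^2(\mathbb{D})$ is the Bergman space of analytic functions on $\mathbb{D}$ that are square integrable with respect to the normalized Lebesgue measure $dV=\pi^{-1}dx\,dy$, with norm $\|f\|_{\mathcal{A}^2}^2=\int_{\mathbb{D}}|f|^2dV$. $\mathbf{D}(z,R)$ is the Euclidean disk with center $z$ and radius $R$. $f^{(k)}$ is the $k$-th complex derivative. In the direct part, "measure" means a (possibly complex) Borel measure, $|\mu|$ is its variation, and "locally finite" means $|\mu|(K)<\infty$ for every compact $K\subset\mathbb{D}$. *)

theory Defs
  imports "HOL-Complex_Analysis.Complex_Analysis"
begin

abbreviation unit_disk :: "complex set"
  where "unit_disk \<equiv> ball 0 1"


subsection \<open>The Bergman space\<close>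

definition disk_measure :: "complex measure"
  where "disk_measure = scale_measure (ennreal (1 / pi)) (restrict_space lborel unit_disk)"

text \<open>Elements are functions on the whole plane; only their values on the disk matter.\<close>

definition bergman_space :: "(complex \<Rightarrow> complex) set"
  where "bergman_space =
    {f. f holomorphic_on unit_disk \<and> integrable disk_measure (\<lambda>z. (norm (f z))\<^sup>2)}"

definition bergman_norm :: "(complex \<Rightarrow> complex) \<Rightarrow> real"
  where "bergman_norm f = sqrt (LINT z|disk_measure. (norm (f z))\<^sup>2)"


subsection \<open>Complex measures on the disk\<close>

text \<open>
  A locally finite complex measure on the disk need not have a value on every Borel set (its
  variation may be infinite on the whole disk). It is therefore a set function on the relatively
  compact Borel subsets of the disk, countably additive as far as unions stay relatively compact.
  Values on other sets are irrelevant.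
\<close>

definition rc_borel :: "complex set set"
  where "rc_borel = {E \<in> sets borel. compact (closure E) \<and> closure E \<subseteq> unit_disk}"

definition complex_measure_on_disk :: "(complex set \<Rightarrow> complex) \<Rightarrow> bool"
  where "complex_measure_on_disk \<mu> \<longleftrightarrow>
    (\<forall>A :: nat \<Rightarrow> complex set.
       range A \<subseteq> rc_borel \<and> disjoint_family A \<and> (\<Union>i. A i) \<in> rc_borel \<longrightarrow>
       (\<lambda>i. \<mu> (A i)) sums \<mu> (\<Union>i. A i))"

text \<open>
  The supremum is over countable partitions into sets on which the measure is defined;
  every Borel subset of the disk has such a partition.
\<close>

definition variation :: "(complex set \<Rightarrow> complex) \<Rightarrow> complex set \<Rightarrow> ennreal"
  where "variation \<mu> E =
    (SUP A \<in> {A :: nat \<Rightarrow> complex set. range A \<subseteq> rc_borel \<and> disjoint_family A \<and> (\<Union>i. A i) = E}.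
       \<Sum>i. ennreal (norm (\<mu> (A i))))"

definition locally_finite :: "(complex set \<Rightarrow> complex) \<Rightarrow> bool"
  where "locally_finite \<mu> \<longleftrightarrow> (\<forall>K. compact K \<and> K \<subseteq> unit_disk \<longrightarrow> variation \<mu> K < \<infinity>)"

text \<open>
  Integration against a complex measure goes through the Jordan decompositions of its real and
  imaginary parts. The positive part of a real set function \<open>r\<close> is
  \<open>r\<^sup>+(E) = sup {r(A) | A \<subseteq> E}\<close> and the negative part is the positive part of \<open>-r\<close>.
  The truncation of negative reals by \<^const>\<open>ennreal\<close> is harmless, as \<open>r {} = 0\<close>.
\<close>

definition upper_variation :: "(complex set \<Rightarrow> real) \<Rightarrow> complex set \<Rightarrow> ennreal"
  where "upper_variation r E = (SUP A \<in> {A \<in> rc_borel. A \<subseteq> E}. ennreal (r A))"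

definition positive_part :: "(complex set \<Rightarrow> real) \<Rightarrow> complex measure"
  where "positive_part r =
    measure_of unit_disk (sets (restrict_space borel unit_disk)) (upper_variation r)"

definition jordan_parts :: "(complex set \<Rightarrow> complex) \<Rightarrow> complex measure set"
  where "jordan_parts \<mu> =
    {positive_part (\<lambda>A. Re (\<mu> A)), positive_part (\<lambda>A. - Re (\<mu> A)),
     positive_part (\<lambda>A. Im (\<mu> A)), positive_part (\<lambda>A. - Im (\<mu> A))}"

definition cm_integrable :: "(complex set \<Rightarrow> complex) \<Rightarrow> (complex \<Rightarrow> real) \<Rightarrow> bool"
  where "cm_integrable \<mu> g \<longleftrightarrow> (\<forall>M \<in> jordan_parts \<mu>. integrable M g)"

definition cm_integral :: "(complex set \<Rightarrow> complex) \<Rightarrow> (complex \<Rightarrow> real) \<Rightarrow> complex"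
  where "cm_integral \<mu> g = Complex
    (integral\<^sup>L (positive_part (\<lambda>A. Re (\<mu> A))) g - integral\<^sup>L (positive_part (\<lambda>A. - Re (\<mu> A))) g)
    (integral\<^sup>L (positive_part (\<lambda>A. Im (\<mu> A))) g - integral\<^sup>L (positive_part (\<lambda>A. - Im (\<mu> A))) g)"


subsection \<open>Carleson quantities\<close>

text \<open>
  The argument \<open>\<nu>\<close> is the variation as a set function; for a positive measure it is the
  measure itself.
\<close>

definition carleson_tau :: "nat \<Rightarrow> (complex set \<Rightarrow> ennreal) \<Rightarrow> ennreal"
  where "carleson_tau k \<nu> =
    (SUP z \<in> unit_disk. \<nu> (ball z (1/2 * (1 - norm z)))
       * ennreal ((1 - norm z) powi (- 2 * (int k + 1))))"

text \<open>
  Integrability is demanded explicitly because the Bochner integral of a non-integrable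
  function is zero.
\<close>

definition carleson_constants :: "nat \<Rightarrow> complex measure \<Rightarrow> real set"
  where "carleson_constants k \<mu> =
    {c. \<forall>f \<in> bergman_space.
       integrable \<mu> (\<lambda>z. (norm ((deriv ^^ k) f z))\<^sup>2) \<and>
       \<bar>LINT z|\<mu>. (norm ((deriv ^^ k) f z))\<^sup>2\<bar> \<le> c * (bergman_norm f)\<^sup>2}"


subsection \<open>The Jordan parts are measures\<close>

lemma rc_borel_subset:
  assumes "A \<in> rc_borel" "B \<in> sets borel" "B \<subseteq> A"
  shows "B \<in> rc_borel"
proof -
  have "closure B \<subseteq> closure A"
    using assms(3) by (rule closure_mono)
  then show ?thesis
    using assms by (auto simp: rc_borel_def compact_eq_bounded_closed intro: bounded_subset)
qed

lemma rc_borel_empty: "{} \<in> rc_borel"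
  by (simp add: rc_borel_def)

lemma rc_borel_Un: "A \<in> rc_borel \<Longrightarrow> B \<in> rc_borel \<Longrightarrow> A \<union> B \<in> rc_borel"
  by (auto simp: rc_borel_def)

definition real_measure_on_disk :: "(complex set \<Rightarrow> real) \<Rightarrow> bool"
  where "real_measure_on_disk r \<longleftrightarrow>
    (\<forall>A :: nat \<Rightarrow> complex set.
       range A \<subseteq> rc_borel \<and> disjoint_family A \<and> (\<Union>i. A i) \<in> rc_borel \<longrightarrow>
       (\<lambda>i. r (A i)) sums r (\<Union>i. A i))"

lemma real_measure_on_disk_parts:
  assumes "complex_measure_on_disk \<mu>"
  shows "real_measure_on_disk (\<lambda>A. Re (\<mu> A))" "real_measure_on_disk (\<lambda>A. - Re (\<mu> A))"
    "real_measure_on_disk (\<lambda>A. Im (\<mu> A))" "real_measure_on_disk (\<lambda>A. - Im (\<mu> A))"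
  using assms unfolding complex_measure_on_disk_def real_measure_on_disk_def
  by (auto intro!: sums_minus sums_Re sums_Im)

lemma real_measure_on_disk_empty:
  assumes "real_measure_on_disk r"
  shows "r {} = 0"
proof -
  have "(\<lambda>i::nat. r {}) sums r {}"
    using assms[unfolded real_measure_on_disk_def, rule_format, of "\<lambda>_. {}"]
    by (simp add: rc_borel_empty disjoint_family_on_def)
  then have "(\<lambda>i::nat. r {}) \<longlonglongrightarrow> 0"
    by (intro summable_LIMSEQ_zero) (rule sums_summable)
  then show ?thesis
    by (simp add: LIMSEQ_const_iff)
qed

lemma real_measure_on_disk_Un:
  assumes r: "real_measure_on_disk r"
    and AB: "A \<in> rc_borel" "B \<in> rc_borel" "A \<inter> B = {}"
  shows "r (A \<union> B) = r A + r B"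
proof -
  let ?X = "binaryset A B"
  have "(\<lambda>i. r (?X i)) sums r (\<Union>i. ?X i)"
  proof (rule r[unfolded real_measure_on_disk_def, rule_format])
    have "disjoint_family ?X"
      using AB by (auto simp: disjoint_family_on_def binaryset_def)
    then show "range ?X \<subseteq> rc_borel \<and> disjoint_family ?X \<and> (\<Union>i. ?X i) \<in> rc_borel"
      using AB by (simp add: UN_binaryset_eq range_binaryset_eq rc_borel_empty rc_borel_Un)
  qed
  moreover have "(\<lambda>i. r (?X i)) sums (r A + r B)"
    using binaryset_sums[of r A B] real_measure_on_disk_empty[OF r] by simp
  ultimately show ?thesis
    by (simp add: UN_binaryset_eq sums_unique2)
qed

lemma upper_variation_add_le:
  assumes r: "real_measure_on_disk r" and EF: "E \<inter> F = {}"
  shows "upper_variation r E + upper_variation r F \<le> upper_variation r (E \<union> F)"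
proof -
  have r0: "r {} = 0"
    by (rule real_measure_on_disk_empty[OF r])
  have *: "ennreal (r A) + ennreal (r B) \<le> upper_variation r (E \<union> F)"
    if A: "A \<in> rc_borel" "A \<subseteq> E" and B: "B \<in> rc_borel" "B \<subseteq> F" for A B
  proof -
    define A' where "A' = (if r A \<ge> 0 then A else {})"
    define B' where "B' = (if r B \<ge> 0 then B else {})"
    have A': "A' \<in> rc_borel" "A' \<subseteq> E" "r A' \<ge> 0" "ennreal (r A) = ennreal (r A')"
      using A r0 by (auto simp: A'_def rc_borel_empty ennreal_neg)
    have B': "B' \<in> rc_borel" "B' \<subseteq> F" "r B' \<ge> 0" "ennreal (r B) = ennreal (r B')"
      using B r0 by (auto simp: B'_def rc_borel_empty ennreal_neg)
    have "r (A' \<union> B') = r A' + r B'"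
      using A' B' EF by (intro real_measure_on_disk_Un[OF r]) auto
    then have "ennreal (r A) + ennreal (r B) = ennreal (r (A' \<union> B'))"
      using A' B' by (simp add: ennreal_plus)
    also have "\<dots> \<le> upper_variation r (E \<union> F)"
      unfolding upper_variation_def using A' B'
      by (intro SUP_upper) (auto intro: rc_borel_Un)
    finally show ?thesis .
  qed
  have ne: "{A \<in> rc_borel. A \<subseteq> X} \<noteq> {}" for X
    using rc_borel_empty by auto
  show ?thesis
    unfolding upper_variation_def[of r E] upper_variation_def[of r F]
    by (subst ennreal_SUP_add_left[symmetric, OF ne], rule SUP_least,
        subst ennreal_SUP_add_right[OF ne], rule SUP_least) (use * in auto)
qed

lemma upper_variation_empty:
  assumes "real_measure_on_disk r"
  shows "upper_variation r {} = 0"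
proof -
  have "{A \<in> rc_borel. A \<subseteq> {}} = {{}}"
    using rc_borel_empty by auto
  then show ?thesis
    using real_measure_on_disk_empty[OF assms] by (simp add: upper_variation_def)
qed

lemma countably_additive_upper_variation:
  assumes r: "real_measure_on_disk r"
  shows "countably_additive (sets (restrict_space borel unit_disk)) (upper_variation r)"
  unfolding countably_additive_def
proof (intro allI impI)
  fix E :: "nat \<Rightarrow> complex set"
  assume ran: "range E \<subseteq> sets (restrict_space borel unit_disk)" and dis: "disjoint_family E"
  have E: "E i \<in> sets borel" for i
  proof -
    have "E i \<in> sets (restrict_space borel unit_disk)"
      using ran by auto
    then show ?thesis
      by (simp add: sets_restrict_space_iff)
  qed
  have "(\<Sum>i<n. upper_variation r (E i)) \<le> upper_variation r (\<Union>i<n. E i)" for n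
  proof (induction n)
    case (Suc n)
    have "(\<Union>i<n. E i) \<inter> E n = {}"
    proof -
      have "E i \<inter> E n = {}" if "i < n" for i
        using that by (intro disjoint_family_onD[OF dis]) auto
      then show ?thesis
        by blast
    qed
    then have "upper_variation r (\<Union>i<n. E i) + upper_variation r (E n)
        \<le> upper_variation r ((\<Union>i<n. E i) \<union> E n)"
      by (rule upper_variation_add_le[OF r])
    moreover have "(\<Union>i<n. E i) \<union> E n = (\<Union>i<Suc n. E i)"
      by (auto simp: lessThan_Suc)
    ultimately show ?case
      using order_trans[OF add_right_mono[OF Suc, of "upper_variation r (E n)"]]
      by (simp only: sum.lessThan_Suc)
  qed (simp add: upper_variation_empty[OF r])
  moreover have "upper_variation r (\<Union>i<n. E i) \<le> upper_variation r (\<Union>i. E i)" for n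
    unfolding upper_variation_def by (rule SUP_subset_mono) auto
  ultimately have "(\<Sum>i. upper_variation r (E i)) \<le> upper_variation r (\<Union>i. E i)"
    by (intro suminf_le_const) (auto intro: order_trans)
  moreover have "upper_variation r (\<Union>i. E i) \<le> (\<Sum>i. upper_variation r (E i))"
    unfolding upper_variation_def[of r "\<Union>i. E i"]
  proof (rule SUP_least)
    fix A assume "A \<in> {A \<in> rc_borel. A \<subseteq> (\<Union>i. E i)}"
    then have A: "A \<in> rc_borel" "A \<subseteq> (\<Union>i. E i)" by auto
    have rc: "A \<inter> E i \<in> rc_borel" for i
      using A(1) E by (intro rc_borel_subset[OF A(1)]) (auto simp: rc_borel_def)
    have U: "(\<Union>i. A \<inter> E i) = A"
      using A(2) by auto
    have "(\<lambda>i. r (A \<inter> E i)) sums r (\<Union>i. A \<inter> E i)"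
    proof (rule r[unfolded real_measure_on_disk_def, rule_format])
      have "disjoint_family (\<lambda>i. A \<inter> E i)"
        by (rule disjoint_family_on_bisimulation[OF dis]) auto
      then show "range (\<lambda>i. A \<inter> E i) \<subseteq> rc_borel \<and> disjoint_family (\<lambda>i. A \<inter> E i)
          \<and> (\<Union>i. A \<inter> E i) \<in> rc_borel"
        unfolding U using rc A(1) by blast
    qed
    then have "(\<lambda>n. ennreal (\<Sum>i<n. r (A \<inter> E i))) \<longlonglongrightarrow> ennreal (r A)"
      unfolding U sums_def by (rule tendsto_ennrealI)
    moreover have "ennreal (\<Sum>i<n. r (A \<inter> E i)) \<le> (\<Sum>i. upper_variation r (E i))" for n
    proof -
      have "ennreal (\<Sum>i<n. r (A \<inter> E i)) \<le> ennreal (\<Sum>i<n. max 0 (r (A \<inter> E i)))"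
        by (intro ennreal_leI sum_mono) auto
      also have "\<dots> = (\<Sum>i<n. ennreal (max 0 (r (A \<inter> E i))))"
        by (simp add: sum_ennreal)
      also have "\<dots> \<le> (\<Sum>i<n. upper_variation r (E i))"
        unfolding upper_variation_def using rc
        by (intro sum_mono SUP_upper2[where i = "A \<inter> E _"]) (auto simp: max_def ennreal_neg)
      also have "\<dots> \<le> (\<Sum>i. upper_variation r (E i))"
        by (rule sum_le_suminf) auto
      finally show ?thesis .
    qed
    ultimately show "ennreal (r A) \<le> (\<Sum>i. upper_variation r (E i))"
      by (intro LIMSEQ_le_const2) auto
  qed
  ultimately show "(\<Sum>i. upper_variation r (E i)) = upper_variation r (\<Union>i. E i)"
    by (rule antisym)
qed

lemma emeasure_positive_part:
  assumes "real_measure_on_disk r" "E \<in> sets borel" "E \<subseteq> unit_disk"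
  shows "emeasure (positive_part r) E = upper_variation r E"
proof (rule emeasure_measure_of[OF positive_part_def])
  show "sets (restrict_space borel unit_disk) \<subseteq> Pow unit_disk"
    by (auto simp: sets_restrict_space)
  have "sets (positive_part r) = sets (restrict_space borel unit_disk)"
    unfolding positive_part_def
    using sets.sigma_sets_eq[of "restrict_space borel unit_disk :: complex measure"]
      sets.space_closed[of "restrict_space borel unit_disk :: complex measure"]
    by (simp add: space_restrict_space)
  then show "E \<in> sets (positive_part r)"
    and "positive (sets (positive_part r)) (upper_variation r)"
    and "countably_additive (sets (positive_part r)) (upper_variation r)"
    using assms countably_additive_upper_variation upper_variation_empty
    by (auto simp: sets_restrict_space_iff positive_def)
qed

end

theory Submission imports Defs
begin

text \<open>
  The argument is local. Near a point \<open>z\<close> at distance \<open>d = 1 - |z|\<close> from the circle, Cauchy's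
  inequality and the area sub-mean value inequality bound \<open>|f\<^sup>(\<^sup>k\<^sup>)(z)|\<^sup>2\<close> by
  \<open>36\<^sup>k\<^sup>+\<^sup>1 (k!)\<^sup>2 d^(-2(k+1))\<close> times the integral of \<open>|f|\<^sup>2\<close> over a disk of radius \<open>d/3\<close>
  (\<open>higher_deriv_bergman_pointwise\<close>). Integrating over \<open>z\<close> against a positive measure and exchanging
  the integrals, each point \<open>\<zeta>\<close> is weighted by the mass of a disk
  \<open>D(\<zeta>, (1 - |\<zeta>|)/2)\<close> times \<open>(1 - |\<zeta>|)^(-2(k+1))\<close>, up to the factor \<open>4\<^sup>k\<^sup>+\<^sup>1\<close> that accounts
  for the variation of the weight over that disk. This is what the Carleson quantity controls
  (\<open>carleson_embedding\<close>). The radii \<open>d/6\<close> and the factor 4 give \<open>36 * 4 = 144\<close>, hence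
  \<open>p = 1/12\<close>.

  For a complex measure the four Jordan parts are dominated by the variation, so the positive case
  applies to each of them.

  For the converse, the inequality is tested on one function for each disk: the exponential function
  for disks near the centre and the Bergman kernel at the centre of the disk for the others
  (\<open>carleson_tau_finite\<close>). This bounds the Carleson quantity by some
  finite number. Once it is finite, the embedding says that
  \<open>144 * 144\<^sup>k * (k!)\<^sup>2\<close> times the Carleson quantity is an admissible constant, so the smallest one,
  which is the infimum of all, does not exceed it.

  The mean value property over disks is obtained from the one over circles by averaging over
  rotations, which replaces polar coordinates by the rotation invariance of area.
\<close>

section \<open>The area sub-mean value inequality\<close>

lemma nn_integral_lborel_translate:
  fixes f :: "'a::euclidean_space \<Rightarrow> ennreal"
  assumes "f \<in> borel_measurable borel"
  shows "(\<integral>\<^sup>+x. f (c + x) \<partial>lborel) = (\<integral>\<^sup>+x. f x \<partial>lborel)"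
proof -
  have "(\<integral>\<^sup>+x. f x \<partial>lborel) = (\<integral>\<^sup>+x. f x \<partial>distr lborel borel ((+) c))"
    by (simp add: lborel_distr_plus)
  also have "\<dots> = (\<integral>\<^sup>+x. f (c + x) \<partial>lborel)"
    using assms by (intro nn_integral_distr) auto
  finally show ?thesis by simp
qed

text \<open>
  Lebesgue measure on the plane is rotation invariant because it is the only translation
  invariant measure up to a factor, and the unit disk fixes the factor. The proof is Weil's
  double integral: integrate \<open>f (a * x) * B (y - a * x)\<close> over both variables, where \<open>B\<close> is the
  indicator of the unit disk, once in each order.
\<close>

lemma nn_integral_lborel_rotate:
  fixes f :: "complex \<Rightarrow> ennreal" and a :: complex
  assumes [measurable]: "f \<in> borel_measurable borel" and a: "norm a = 1"
  shows "(\<integral>\<^sup>+x. f (a * x) \<partial>lborel) = (\<integral>\<^sup>+x. f x \<partial>lborel)"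
proof -
  define B :: "complex \<Rightarrow> ennreal" where "B = indicator (ball 0 1)"
  have [measurable]: "B \<in> borel_measurable borel"
    unfolding B_def by (intro borel_measurable_indicator) auto
  have B_rot: "B (- (a * x)) = B x" for x
    using a by (auto simp: B_def indicator_def norm_mult)
  have a0: "a \<noteq> 0" using a by auto
  let ?m = "\<integral>\<^sup>+y. B y \<partial>lborel"
  have "?m * (\<integral>\<^sup>+x. f (a * x) \<partial>lborel) = (\<integral>\<^sup>+x. (\<integral>\<^sup>+y. f (a * x) * B y \<partial>lborel) \<partial>lborel)"
    by (simp add: nn_integral_cmult nn_integral_multc mult.commute)
  also have "\<dots> = (\<integral>\<^sup>+x. (\<integral>\<^sup>+y. f (a * x) * B (- (a * x) + y) \<partial>lborel) \<partial>lborel)"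
    using nn_integral_lborel_translate[of B "- (a * _)"] by (simp add: nn_integral_cmult)
  also have "\<dots> = (\<integral>\<^sup>+y. (\<integral>\<^sup>+x. f (a * x) * B (- (a * x) + y) \<partial>lborel) \<partial>lborel)"
    by (rule lborel_pair.Fubini') measurable
  \<comment> \<open>The substitution \<open>x \<mapsto> y/a + x\<close> turns \<open>y - a * x\<close> into \<open>- a * x\<close>.\<close>
  also have "\<dots> = (\<integral>\<^sup>+y. (\<integral>\<^sup>+x. f (a * (y / a + x)) * B (- (a * (y / a + x)) + y) \<partial>lborel) \<partial>lborel)"
    by (subst nn_integral_lborel_translate[where f = "\<lambda>x. f (a * x) * B (- (a * x) + _)"]) simp_all
  also have "\<dots> = (\<integral>\<^sup>+y. (\<integral>\<^sup>+x. f (a * x + y) * B x \<partial>lborel) \<partial>lborel)"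
    using a0 by (simp add: distrib_left B_rot add.commute)
  also have "\<dots> = (\<integral>\<^sup>+x. (\<integral>\<^sup>+y. f (a * x + y) * B x \<partial>lborel) \<partial>lborel)"
    by (rule lborel_pair.Fubini') measurable
  also have "\<dots> = ?m * (\<integral>\<^sup>+x. f x \<partial>lborel)"
    by (simp add: nn_integral_multc nn_integral_cmult nn_integral_lborel_translate mult.commute)
  finally have eq: "?m * (\<integral>\<^sup>+x. f (a * x) \<partial>lborel) = ?m * (\<integral>\<^sup>+x. f x \<partial>lborel)" .
  have "?m = ennreal pi"
    by (simp add: B_def emeasure_ball unit_ball_vol_2)
  then have "?m \<noteq> 0" "?m \<noteq> \<infinity>"
    by (auto simp: ennreal_eq_0_iff not_le)
  with eq show ?thesis
    by (simp add: ennreal_mult_cancel_left)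
qed

text \<open>
  The circle is parametrised starting at the arbitrary vector \<open>v\<close> rather than at a positive real,
  so that \<open>v\<close> can later be integrated over a disk without polar coordinates.
\<close>

lemma norm_le_nn_integral_circle:
  fixes g :: "complex \<Rightarrow> complex"
  assumes g: "g holomorphic_on ball w \<rho>" and v: "norm v < \<rho>"
  shows "ennreal (norm (g w))
    \<le> (\<integral>\<^sup>+t. indicator {0..1} t * ennreal (norm (g (w + cis (2 * pi * t) * v))) \<partial>lborel)"
proof -
  define h where "h = (\<lambda>z. g (w + z * v))"
  have "w + z * v \<in> ball w \<rho>" if "norm z \<le> 1" for z
    using that v mult_right_mono[OF that norm_ge_zero[of v]] by (auto simp: dist_norm norm_mult)
  then have img: "(\<lambda>z. w + z * v) ` cball 0 1 \<subseteq> ball w \<rho>"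
    by auto
  have h: "h holomorphic_on cball 0 1"
    unfolding h_def
    by (rule holomorphic_on_compose_gen[OF _ g img, unfolded o_def])
       (intro holomorphic_intros)
  have "((\<lambda>u. h u / (u - 0)) has_contour_integral (2 * of_real pi * \<i> * h 0)) (circlepath 0 1)"
    using h by (intro Cauchy_integral_circlepath_simple) auto
  then have "((\<lambda>t. h (circlepath 0 1 t) / circlepath 0 1 t
      * vector_derivative (circlepath 0 1) (at t within {0..1})) has_integral (2 * of_real pi * \<i> * h 0)) {0..1}"
    by (simp add: has_contour_integral_def)
  then have "((\<lambda>t. 2 * of_real pi * \<i> * h (cis (2 * pi * t))) has_integral (2 * of_real pi * \<i> * h 0)) {0..1}"
    by (rule has_integral_eq[rotated])
       (simp add: vector_derivative_circlepath01, simp add: circlepath cis_conv_exp mult_ac)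
  then have "((\<lambda>t. h (cis (2 * pi * t))) has_integral h 0) {0..1}"
    using has_integral_mult_right[of "\<lambda>t. 2 * of_real pi * \<i> * h (cis (2 * pi * t))" "2 * of_real pi * \<i> * h 0" "{0..1}" "1 / (2 * of_real pi * \<i>)"]
    by simp
  then have int: "integral {0..1} (\<lambda>t. h (cis (2 * pi * t))) = h 0"
    by (rule integral_unique)
  have "continuous_on {0..1} (\<lambda>t. h (cis (2 * pi * t)))"
    by (rule continuous_on_compose2[OF holomorphic_on_imp_continuous_on[OF h]])
       (auto intro!: continuous_intros)
  then have si: "set_integrable lborel {0..1} (\<lambda>t. h (cis (2 * pi * t)))"
    by (rule borel_integrable_atLeastAtMost')
  have "h 0 = (LINT t:{0..1}|lborel. h (cis (2 * pi * t)))"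
    using set_borel_integral_eq_integral(2)[OF si] int by simp
  then have "ennreal (norm (h 0)) \<le> (\<integral>\<^sup>+t. ennreal (norm (indicator {0..1} t *\<^sub>R h (cis (2 * pi * t)))) \<partial>lborel)"
    using integral_norm_bound_ennreal[OF si[unfolded set_integrable_def]]
    by (simp add: set_lebesgue_integral_def)
  also have "\<dots> = (\<integral>\<^sup>+t. indicator {0..1} t * ennreal (norm (g (w + cis (2 * pi * t) * v))) \<partial>lborel)"
    by (intro nn_integral_cong) (auto simp: h_def indicator_def)
  finally show ?thesis
    by (simp add: h_def)
qed

text \<open>
  The circle mean value property of \<open>f\<^sup>2\<close> is averaged over all \<open>v\<close> in the disk. Exchanging the
  integrals leaves, for every angle, the integral of \<open>|f|\<^sup>2\<close> over a rotated disk, which is the disk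
  itself.
\<close>

lemma holomorphic_sub_mean_value:
  fixes f :: "complex \<Rightarrow> complex"
  assumes f: "f holomorphic_on ball w \<rho>" and "\<rho> > 0"
  shows "ennreal (pi * \<rho>\<^sup>2) * ennreal ((norm (f w))\<^sup>2)
    \<le> (\<integral>\<^sup>+z\<in>ball w \<rho>. ennreal ((norm (f z))\<^sup>2) \<partial>lborel)"
proof -
  \<comment> \<open>Extension by zero makes the integrand Borel measurable on the whole plane.\<close>
  define F where "F = (\<lambda>z. indicator (ball w \<rho>) z *\<^sub>R f z)"
  have F[measurable]: "F \<in> borel_measurable borel"
    unfolding F_def using f
    by (intro borel_measurable_continuous_on_indicator holomorphic_on_imp_continuous_on) auto
  define G where "G = (\<lambda>z. ennreal ((norm (F z))\<^sup>2))"
  have [measurable]: "G \<in> borel_measurable borel"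
    unfolding G_def by measurable
  have sq: "(\<lambda>z. (f z)\<^sup>2) holomorphic_on ball w \<rho>"
    using f by (intro holomorphic_intros)
  have "ennreal (pi * \<rho>\<^sup>2) * ennreal ((norm (f w))\<^sup>2)
      = (\<integral>\<^sup>+v. indicator (ball 0 \<rho>) v * ennreal ((norm (f w))\<^sup>2) \<partial>(lborel :: complex measure))"
    using \<open>\<rho> > 0\<close> by (subst nn_integral_multc) (auto simp: emeasure_ball unit_ball_vol_2 intro!: borel_measurable_indicator)
  also have "\<dots> \<le> (\<integral>\<^sup>+v. (\<integral>\<^sup>+t. indicator {0..1} t * G (w + cis (2 * pi * t) * v) \<partial>lborel) \<partial>(lborel :: complex measure))"
  proof (rule nn_integral_mono)
    fix v :: complex
    show "indicator (ball 0 \<rho>) v * ennreal ((norm (f w))\<^sup>2)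
      \<le> (\<integral>\<^sup>+t. indicator {0..1} t * G (w + cis (2 * pi * t) * v) \<partial>lborel)"
    proof (cases "v \<in> ball 0 \<rho>")
      case True
      then have "ennreal (norm ((f w)\<^sup>2))
        \<le> (\<integral>\<^sup>+t. indicator {0..1} t * ennreal (norm ((f (w + cis (2 * pi * t) * v))\<^sup>2)) \<partial>lborel)"
        by (intro norm_le_nn_integral_circle[OF sq]) auto
      also have "\<dots> = (\<integral>\<^sup>+t. indicator {0..1} t * G (w + cis (2 * pi * t) * v) \<partial>lborel)"
        using True by (intro nn_integral_cong) (simp add: G_def F_def dist_norm norm_mult norm_power)
      finally show ?thesis
        using True by (simp add: norm_power)
    qed simp
  qed
  also have "\<dots> = (\<integral>\<^sup>+t. (\<integral>\<^sup>+v. indicator {0..1} t * G (w + cis (2 * pi * t) * v) \<partial>(lborel :: complex measure)) \<partial>lborel)"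
    by (rule lborel_pair.Fubini') (simp add: cis_conv_exp)
  also have "\<dots> = (\<integral>\<^sup>+t. indicator {0..1::real} t * (\<integral>\<^sup>+v. G v \<partial>lborel) \<partial>lborel)"
    by (simp add: nn_integral_cmult nn_integral_lborel_rotate[where f = "\<lambda>v. G (w + v)"]
        nn_integral_lborel_translate)
  also have "\<dots> = (\<integral>\<^sup>+v. G v \<partial>lborel)"
    by (simp add: nn_integral_multc)
  also have "\<dots> = (\<integral>\<^sup>+z\<in>ball w \<rho>. ennreal ((norm (f z))\<^sup>2) \<partial>lborel)"
    by (intro nn_integral_cong) (auto simp: G_def F_def indicator_def)
  finally show ?thesis .
qed

section \<open>Pointwise bounds for derivatives\<close>

lemma carleson_weight: "(x::real) powi (- 2 * (int k + 1)) = 1 / x ^ (2 * k + 2)"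
proof -
  have "- 2 * (int k + 1) = - int (2 * k + 2)" by simp
  then show ?thesis
    by (simp only: power_int_minus power_int_of_nat inverse_eq_divide)
qed

lemma double_even_power: "(2 * x) ^ (2 * k + 2) = 4 ^ (k + 1) * (x::real) ^ (2 * k + 2)"
proof -
  have "(2 * x) ^ (2 * (k + 1)) = (4 * x\<^sup>2) ^ (k + 1)"
    by (simp only: power_mult power_mult_distrib) simp
  also have "\<dots> = 4 ^ (k + 1) * x ^ (2 * (k + 1))"
    by (simp only: power_mult power_mult_distrib)
  finally show ?thesis by simp
qed

text \<open>
  With \<open>d = 1 - |z|\<close>, Cauchy's inequality on the circle of radius \<open>d/6\<close> about \<open>z\<close> costs
  \<open>k! (d/6)\<^sup>-\<^sup>k\<close>, and on that circle \<open>|f|\<^sup>2\<close> is at most its mean over a disk of radius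
  \<open>d/6\<close>, which still lies in the disk of radius \<open>d/3\<close> about \<open>z\<close>. The radius \<open>d/3\<close> is what makes
  \<open>|\<zeta> - z| < d/3\<close> imply \<open>|\<zeta> - z| < (1 - |\<zeta>|)/2\<close>, so that the roles of \<open>z\<close> and
  \<open>\<zeta>\<close> can be exchanged.
\<close>

lemma higher_deriv_bergman_pointwise:
  assumes f: "f holomorphic_on unit_disk" and z: "norm z < 1"
  shows "ennreal ((norm ((deriv ^^ k) f z))\<^sup>2)
    \<le> ennreal (36 * 36 ^ k * (fact k)\<^sup>2 / pi * (1 / (1 - norm z) ^ (2 * k + 2)))
       * (\<integral>\<^sup>+\<zeta>\<in>ball z ((1 - norm z) / 3). ennreal ((norm (f \<zeta>))\<^sup>2) \<partial>lborel)"
    (is "_ \<le> ennreal ?c * ?I")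
proof (cases "?I = \<infinity>")
  case True
  have "?c > 0" using z by simp
  then have "ennreal ?c * ?I = \<infinity>"
    unfolding True by (simp only: ennreal_mult_eq_top_iff infinity_ennreal_def) (auto simp: ennreal_eq_0_iff)
  then show ?thesis by simp
next
  case False
  define d where "d = 1 - norm z"
  have d: "d > 0" using z by (simp add: d_def)
  define B where "B = enn2real ?I"
  have B: "?I = ennreal B" "B \<ge> 0"
    using False by (simp_all add: B_def less_top)
  have sub: "ball z d \<subseteq> unit_disk"
  proof
    fix x assume "x \<in> ball z d"
    then show "x \<in> unit_disk"
      using norm_triangle_ineq2[of x z] by (simp add: d_def dist_norm norm_minus_commute)
  qed
  have bound: "(norm (f w))\<^sup>2 \<le> 36 * B / (pi * d\<^sup>2)" if w: "norm (z - w) = d / 6" for w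
  proof -
    have inc: "ball w (d / 6) \<subseteq> ball z (d / 3)"
    proof
      fix x assume "x \<in> ball w (d / 6)"
      then show "x \<in> ball z (d / 3)"
        using w dist_triangle[of z x w] by (simp add: dist_norm)
    qed
    also have "\<dots> \<subseteq> unit_disk"
      using sub d by (force simp: subset_iff)
    finally have "f holomorphic_on ball w (d / 6)"
      by (rule holomorphic_on_subset[OF f])
    then have "ennreal (pi * (d / 6)\<^sup>2) * ennreal ((norm (f w))\<^sup>2)
        \<le> (\<integral>\<^sup>+\<zeta>\<in>ball w (d / 6). ennreal ((norm (f \<zeta>))\<^sup>2) \<partial>lborel)"
      using d by (intro holomorphic_sub_mean_value) auto
    also have "\<dots> \<le> ?I"
      using inc unfolding d_def by (intro nn_integral_mono) (auto simp: indicator_def)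
    finally have "pi * (d / 6)\<^sup>2 * (norm (f w))\<^sup>2 \<le> B"
      using B by (simp add: ennreal_mult'[symmetric])
    then show ?thesis
      using d by (simp add: field_simps power2_eq_square)
  qed
  have "norm ((deriv ^^ k) f z) \<le> fact k * sqrt (36 * B / (pi * d\<^sup>2)) / (d / 6) ^ k"
  proof (rule Cauchy_inequality)
    have "cball z (d / 6) \<subseteq> unit_disk"
      using sub d by (force simp: subset_iff)
    then show "continuous_on (cball z (d / 6)) f" "f holomorphic_on ball z (d / 6)"
      using f holomorphic_on_subset[OF f] ball_subset_cball[of z "d / 6"]
      by (blast intro: holomorphic_on_imp_continuous_on continuous_on_subset)+
    show "norm (f w) \<le> sqrt (36 * B / (pi * d\<^sup>2))" if "norm (z - w) = d / 6" for w
      using bound[OF that] by (rule real_le_rsqrt)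
  qed (use d in auto)
  then have "(norm ((deriv ^^ k) f z))\<^sup>2 \<le> (fact k * sqrt (36 * B / (pi * d\<^sup>2)) / (d / 6) ^ k)\<^sup>2"
    by (intro power_mono) auto
  also have "\<dots> = (fact k)\<^sup>2 * (36 * B / (pi * d\<^sup>2)) / (d / 6) ^ (2 * k)"
    using B d by (simp add: power_mult_distrib power_divide power_mult[symmetric] mult.commute)
  also have "\<dots> = ?c * B"
    using d power_mult_distrib[of 6 "6::real" k]
    by (simp add: d_def[symmetric] power_divide power_add power_mult field_simps power2_eq_square)
  finally have "ennreal ((norm ((deriv ^^ k) f z))\<^sup>2) \<le> ennreal (?c * B)"
    by (rule ennreal_leI)
  also have "\<dots> = ennreal ?c * ?I"
    unfolding B(1) using B(2) z by (intro ennreal_mult) auto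
  finally show ?thesis .
qed

section \<open>The embedding for positive measures\<close>

lemma half_ball_subset_disk:
  assumes "z \<in> unit_disk"
  shows "ball z (1/2 * (1 - norm z)) \<subseteq> unit_disk"
proof
  fix x assume "x \<in> ball z (1/2 * (1 - norm z))"
  then show "x \<in> unit_disk"
    using assms norm_triangle_sub[of x z] by (simp add: dist_norm norm_minus_commute)
qed

text \<open>
  Countably many of the disks of the Carleson condition cover the unit disk. Sigma-finiteness is
  what Tonelli's theorem needs in the embedding.
\<close>

lemma disk_ball_cover_sigma_finite:
  fixes M :: "complex measure"
  assumes M: "sets M = sets (restrict_space borel unit_disk)"
    and fin: "\<And>z. z \<in> unit_disk \<Longrightarrow> emeasure M (ball z (1/2 * (1 - norm z))) < \<infinity>"
  shows "sigma_finite_measure M"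
proof
  define \<F> where "\<F> = (\<lambda>z. ball z (1/2 * (1 - norm z))) ` unit_disk"
  have sp: "space M = unit_disk"
    using sets_eq_imp_space_eq[OF M] by (simp add: space_restrict_space)
  obtain \<F>' where F': "\<F>' \<subseteq> \<F>" "countable \<F>'" "\<Union>\<F>' = \<Union>\<F>"
    using Lindelof[of \<F>] by (auto simp: \<F>_def)
  have sub: "S \<subseteq> unit_disk" if "S \<in> \<F>" for S
    using that half_ball_subset_disk by (auto simp only: \<F>_def)
  have "\<Union>\<F> = unit_disk"
  proof
    show "\<Union>\<F> \<subseteq> unit_disk" using sub by blast
    show "unit_disk \<subseteq> \<Union>\<F>"
      by (auto simp: \<F>_def intro!: bexI)
  qed
  moreover have "\<F>' \<subseteq> sets M"
    using F'(1) sub by (auto simp: M sets_restrict_space_iff \<F>_def)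
  moreover have "\<forall>a\<in>\<F>'. emeasure M a \<noteq> \<infinity>"
    using F'(1) fin by (fastforce simp: \<F>_def)
  ultimately show "\<exists>A. countable A \<and> A \<subseteq> sets M \<and> \<Union>A = space M \<and> (\<forall>a\<in>A. emeasure M a \<noteq> \<infinity>)"
    using F' sp by (intro exI[of _ \<F>']) auto
qed

lemma carleson_tau_finite_imp_ball_finite:
  assumes "carleson_tau k \<nu> < \<infinity>" "z \<in> unit_disk"
  shows "\<nu> (ball z (1/2 * (1 - norm z))) < \<infinity>"
proof -
  have "\<nu> (ball z (1/2 * (1 - norm z))) * ennreal ((1 - norm z) powi (- 2 * (int k + 1))) \<le> carleson_tau k \<nu>"
    unfolding carleson_tau_def by (rule SUP_upper[OF assms(2)])
  also note assms(1)
  finally have "\<nu> (ball z (1/2 * (1 - norm z))) * ennreal ((1 - norm z) powi (- 2 * (int k + 1))) < \<infinity>" .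
  moreover have "(1 - norm z) powi (- 2 * (int k + 1)) > 0"
    using assms(2) by (intro zero_less_power_int) auto
  ultimately show ?thesis
    by (auto simp: ennreal_mult_less_top ennreal_eq_0_iff)
qed

lemma borel_measurable_disk_extension:
  fixes f :: "complex \<Rightarrow> complex"
  assumes "f holomorphic_on unit_disk"
  shows "(\<lambda>z. indicator unit_disk z *\<^sub>R f z) \<in> borel_measurable borel"
  using assms by (intro borel_measurable_continuous_on_indicator holomorphic_on_imp_continuous_on) auto

lemma higher_deriv_measurable_disk:
  assumes M: "sets M = sets (restrict_space borel unit_disk)" and f: "f holomorphic_on unit_disk"
  shows "(\<lambda>z. (norm ((deriv ^^ k) f z))\<^sup>2) \<in> borel_measurable M"
proof -
  have "continuous_on unit_disk ((deriv ^^ k) f)"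
    using f by (intro holomorphic_on_imp_continuous_on holomorphic_higher_deriv) auto
  then have "(\<lambda>z. (norm ((deriv ^^ k) f z))\<^sup>2) \<in> borel_measurable (restrict_space borel unit_disk)"
    by (intro borel_measurable_continuous_on_restrict continuous_intros)
  then show ?thesis
    by (simp cong: measurable_cong_sets add: measurable_cong_sets[OF M refl])
qed

text \<open>
  Insert the pointwise bound and exchange the integrals. For fixed \<open>\<zeta>\<close>, the points \<open>z\<close> that see
  \<open>\<zeta>\<close> lie in the disk of radius \<open>(1 - |\<zeta>|)/2\<close> about \<open>\<zeta>\<close>, and there
  \<open>1 - |\<zeta>| \<le> 2 (1 - |z|)\<close>; so the inner integral is at most \<open>4^(k+1)\<close> times a quantity from the
  supremum that defines \<^const>\<open>carleson_tau\<close>.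
\<close>

lemma carleson_embedding_nn:
  fixes M :: "complex measure"
  assumes M: "sets M = sets (restrict_space borel unit_disk)"
    and tau: "carleson_tau k (emeasure M) < \<infinity>"
    and f: "f holomorphic_on unit_disk"
  shows "(\<integral>\<^sup>+z. ennreal ((norm ((deriv ^^ k) f z))\<^sup>2) \<partial>M)
    \<le> ennreal (144 * 144 ^ k * (fact k)\<^sup>2 / pi) * carleson_tau k (emeasure M)
       * (\<integral>\<^sup>+\<zeta>\<in>unit_disk. ennreal ((norm (f \<zeta>))\<^sup>2) \<partial>lborel)"
proof -
  let ?T = "carleson_tau k (emeasure M)"
  have sp: "space M = unit_disk"
    using sets_eq_imp_space_eq[OF M] by (simp add: space_restrict_space)
  interpret M: sigma_finite_measure M
    using carleson_tau_finite_imp_ball_finite[OF tau] by (intro disk_ball_cover_sigma_finite M) auto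
  interpret P: pair_sigma_finite M "lborel :: complex measure"
    by standard
  \<comment> \<open>Extended by zero, so that the outer integral can run over the whole plane.\<close>
  define F where "F = (\<lambda>\<zeta>. ennreal ((norm (indicator unit_disk \<zeta> *\<^sub>R f \<zeta>))\<^sup>2))"
  have F[measurable]: "F \<in> borel_measurable borel"
    using borel_measurable_disk_extension[OF f] unfolding F_def by measurable
  define c :: real where "c = 36 * 36 ^ k * (fact k)\<^sup>2 / pi"
  have c: "c \<ge> 0" by (simp add: c_def)
  define W where "W = (\<lambda>z::complex. ennreal (c * (1 / (1 - norm z) ^ (2 * k + 2))))"
  define K where "K = (\<lambda>z \<zeta>. W z * (indicator {u. norm (snd u - fst u) < (1 - norm (fst u)) / 3} (z, \<zeta>) * F \<zeta>))"
  have [measurable]: "W \<in> borel_measurable borel"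
    unfolding W_def by measurable
  have M_borel: "(\<lambda>z. z) \<in> M \<rightarrow>\<^sub>M borel"
    by (subst measurable_cong_sets[OF M refl]) (rule measurable_restrict_space1, simp)
  have indK: "{u::complex \<times> complex. norm (snd u - fst u) < (1 - norm (fst u)) / 3} \<in> sets (borel \<Otimes>\<^sub>M borel)"
    unfolding borel_prod by (intro borel_open open_Collect_less continuous_intros) auto
  have fst_meas: "fst \<in> M \<Otimes>\<^sub>M lborel \<rightarrow>\<^sub>M borel"
    by (rule measurable_compose[OF measurable_fst M_borel])
  have snd_meas: "snd \<in> M \<Otimes>\<^sub>M lborel \<rightarrow>\<^sub>M borel"
    by (rule measurable_compose[OF measurable_snd]) simp
  have "(\<lambda>(z, \<zeta>). K z \<zeta>) \<in> borel_measurable (borel \<Otimes>\<^sub>M borel)"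
    unfolding K_def using indK by measurable
  then have K_meas: "(\<lambda>(z, \<zeta>). K z \<zeta>) \<in> borel_measurable (M \<Otimes>\<^sub>M lborel)"
    using measurable_compose[OF measurable_Pair[OF fst_meas snd_meas]] by (simp add: case_prod_beta)
  have "(\<integral>\<^sup>+z. ennreal ((norm ((deriv ^^ k) f z))\<^sup>2) \<partial>M)
      \<le> (\<integral>\<^sup>+z. (\<integral>\<^sup>+\<zeta>. K z \<zeta> \<partial>lborel) \<partial>M)"
  proof (rule nn_integral_mono)
    fix z assume "z \<in> space M"
    then have z: "norm z < 1" using sp by simp
    have *: "indicator {u. norm (snd u - fst u) < (1 - norm (fst u)) / 3} (z, \<zeta>) * F \<zeta>
        = ennreal ((norm (f \<zeta>))\<^sup>2) * indicator (ball z ((1 - norm z) / 3)) \<zeta>" for \<zeta>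
    proof (cases "norm (\<zeta> - z) < (1 - norm z) / 3")
      case True
      then have "norm \<zeta> < 1"
        using norm_triangle_sub[of \<zeta> z] z by simp
      then show ?thesis
        using True by (simp add: F_def dist_norm norm_minus_commute)
    qed (simp add: dist_norm norm_minus_commute)
    have "(\<lambda>\<zeta>. ennreal ((norm (f \<zeta>))\<^sup>2) * indicator (ball z ((1 - norm z) / 3)) \<zeta>) \<in> borel_measurable borel"
    proof -
      have "(\<lambda>\<zeta>. indicator (ball z ((1 - norm z) / 3)) \<zeta> * F \<zeta>) \<in> borel_measurable borel"
        by (intro borel_measurable_times_ennreal borel_measurable_indicator F) auto
      then show ?thesis
        unfolding *[symmetric] by (simp add: indicator_def dist_norm norm_minus_commute)
    qed
    then have "(\<integral>\<^sup>+\<zeta>. K z \<zeta> \<partial>lborel)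
        = W z * (\<integral>\<^sup>+\<zeta>\<in>ball z ((1 - norm z) / 3). ennreal ((norm (f \<zeta>))\<^sup>2) \<partial>lborel)"
      unfolding K_def * by (intro nn_integral_cmult) simp
    then show "ennreal ((norm ((deriv ^^ k) f z))\<^sup>2) \<le> (\<integral>\<^sup>+\<zeta>. K z \<zeta> \<partial>lborel)"
      using higher_deriv_bergman_pointwise[OF f z, of k] by (simp add: W_def c_def)
  qed
  also have "\<dots> = (\<integral>\<^sup>+\<zeta>. (\<integral>\<^sup>+z. K z \<zeta> \<partial>M) \<partial>lborel)"
    by (rule P.Fubini'[OF K_meas, symmetric])
  also have "\<dots> \<le> (\<integral>\<^sup>+\<zeta>. ennreal (c * 4 ^ (k + 1)) * ?T * F \<zeta> \<partial>lborel)"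
  proof (rule nn_integral_mono)
    fix \<zeta> :: complex
    show "(\<integral>\<^sup>+z. K z \<zeta> \<partial>M) \<le> ennreal (c * 4 ^ (k + 1)) * ?T * F \<zeta>"
    proof (cases "\<zeta> \<in> unit_disk")
      case True
      define e where "e = 1 - norm \<zeta>"
      have e: "e > 0" using True by (simp add: e_def)
      define B where "B = ball \<zeta> (1/2 * (1 - norm \<zeta>))"
      have B: "B \<in> sets M"
        using half_ball_subset_disk[OF True] by (simp add: M sets_restrict_space_iff B_def)
      let ?w = "ennreal (e powi (- 2 * (int k + 1)))"
      have "K z \<zeta> \<le> ennreal (c * 4 ^ (k + 1)) * ?w * F \<zeta> * indicator B z" if "z \<in> space M" for z
      proof (cases "norm (\<zeta> - z) < (1 - norm z) / 3")
        case True
        have z: "norm z < 1" using that sp by simp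
        have tri: "norm \<zeta> \<le> norm z + norm (\<zeta> - z)" "norm z \<le> norm \<zeta> + norm (\<zeta> - z)"
          using norm_triangle_sub[of \<zeta> z] norm_triangle_sub[of z \<zeta>]
          by (simp_all add: norm_minus_commute)
        have "norm (\<zeta> - z) < 1/2 * e"
          using True tri unfolding e_def by argo
        then have "z \<in> B"
          by (simp add: B_def e_def dist_norm)
        have "e \<le> 2 * (1 - norm z)"
          using True tri z unfolding e_def by argo
        then have "e ^ (2 * k + 2) \<le> (2 * (1 - norm z)) ^ (2 * k + 2)"
          using e by (intro power_mono) auto
        also have "\<dots> = 4 ^ (k + 1) * (1 - norm z) ^ (2 * k + 2)"
          by (rule double_even_power)
        finally have "e ^ (2 * k + 2) \<le> 4 ^ (k + 1) * (1 - norm z) ^ (2 * k + 2)" .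
        moreover have "1 / y \<le> c * (1 / x)" if "0 < x" "0 < y" "x \<le> c * y" for x y c :: real
          using that by (simp add: field_simps)
        ultimately have "1 / (1 - norm z) ^ (2 * k + 2) \<le> 4 ^ (k + 1) * (1 / e ^ (2 * k + 2))"
          using e z by simp
        from mult_left_mono[OF this c]
        have "W z \<le> ennreal (c * 4 ^ (k + 1) * (1 / e ^ (2 * k + 2)))"
          unfolding W_def by (intro ennreal_leI) (simp only: mult.assoc)
        also have "\<dots> = ennreal (c * 4 ^ (k + 1)) * ?w"
          unfolding carleson_weight using c e by (intro ennreal_mult) auto
        finally have "W z \<le> ennreal (c * 4 ^ (k + 1)) * ?w" .
        then show ?thesis
          using True \<open>z \<in> B\<close> by (simp add: K_def mult_right_mono)
      qed (simp add: K_def)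
      then have "(\<integral>\<^sup>+z. K z \<zeta> \<partial>M) \<le> (\<integral>\<^sup>+z. ennreal (c * 4 ^ (k + 1)) * ?w * F \<zeta> * indicator B z \<partial>M)"
        by (rule nn_integral_mono)
      also have "\<dots> = ennreal (c * 4 ^ (k + 1)) * (emeasure M B * ?w) * F \<zeta>"
        using B by (subst nn_integral_cmult_indicator) (simp_all add: mult_ac)
      also have "\<dots> \<le> ennreal (c * 4 ^ (k + 1)) * ?T * F \<zeta>"
        unfolding carleson_tau_def B_def e_def
        by (intro mult_right_mono mult_left_mono SUP_upper[OF True]) auto
      finally show ?thesis .
    qed (simp add: K_def F_def)
  qed
  also have "\<dots> = ennreal (c * 4 ^ (k + 1)) * ?T * (\<integral>\<^sup>+\<zeta>. F \<zeta> \<partial>lborel)"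
    by (intro nn_integral_cmult) simp
  also have "c * 4 ^ (k + 1) = 144 * 144 ^ k * (fact k)\<^sup>2 / pi"
    using power_mult_distrib[of 36 "4::real" k] by (simp add: c_def)
  also have "(\<integral>\<^sup>+\<zeta>. F \<zeta> \<partial>lborel) = (\<integral>\<^sup>+\<zeta>\<in>unit_disk. ennreal ((norm (f \<zeta>))\<^sup>2) \<partial>lborel)"
    by (intro nn_integral_cong) (auto simp: F_def indicator_def)
  finally show ?thesis .
qed

lemma space_disk_measure: "space disk_measure = unit_disk"
  by (simp add: disk_measure_def space_scale_measure space_restrict_space)

lemma sets_disk_measure: "sets disk_measure = sets (restrict_space borel unit_disk)"
  by (simp add: disk_measure_def sets_restrict_space)

lemma nn_integral_disk_measure:
  assumes "g \<in> borel_measurable disk_measure"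
  shows "(\<integral>\<^sup>+z. g z \<partial>disk_measure) = ennreal (1 / pi) * (\<integral>\<^sup>+z\<in>unit_disk. g z \<partial>lborel)"
  using assms unfolding disk_measure_def
  by (subst nn_integral_scale_measure) (simp_all add: nn_integral_restrict_space measurable_def space_scale_measure)

lemma bergman_norm_sq:
  assumes "f \<in> bergman_space"
  shows "ennreal ((bergman_norm f)\<^sup>2) = (\<integral>\<^sup>+z. ennreal ((norm (f z))\<^sup>2) \<partial>disk_measure)"
  using assms by (simp add: bergman_space_def bergman_norm_def nn_integral_eq_integral)

lemma carleson_embedding:
  fixes M :: "complex measure"
  assumes M: "sets M = sets (restrict_space borel unit_disk)"
    and tau: "carleson_tau k (emeasure M) < \<infinity>"
    and f: "f \<in> bergman_space"
  shows "integrable M (\<lambda>z. (norm ((deriv ^^ k) f z))\<^sup>2)"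
    and "(LINT z|M. (norm ((deriv ^^ k) f z))\<^sup>2)
      \<le> 144 * 144 ^ k * (fact k)\<^sup>2 * enn2real (carleson_tau k (emeasure M)) * (bergman_norm f)\<^sup>2"
proof -
  let ?T = "carleson_tau k (emeasure M)"
  have hol: "f holomorphic_on unit_disk"
    using f by (simp add: bergman_space_def)
  have meas: "(\<lambda>z. (norm ((deriv ^^ k) f z))\<^sup>2) \<in> borel_measurable M"
    by (rule higher_deriv_measurable_disk[OF M hol])
  have T: "?T = ennreal (enn2real ?T)"
    using tau by (simp add: less_top)
  have "ennreal ((bergman_norm f)\<^sup>2) = ennreal (1 / pi) * (\<integral>\<^sup>+z\<in>unit_disk. ennreal ((norm (f z))\<^sup>2) \<partial>lborel)"
    unfolding bergman_norm_sq[OF f]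
    using higher_deriv_measurable_disk[OF sets_disk_measure hol, of 0]
    by (intro nn_integral_disk_measure) simp
  then have N: "(\<integral>\<^sup>+z\<in>unit_disk. ennreal ((norm (f z))\<^sup>2) \<partial>lborel) = ennreal (pi * (bergman_norm f)\<^sup>2)"
    by (simp add: ennreal_mult mult.assoc[symmetric] ennreal_mult'[symmetric])
  have le: "(\<integral>\<^sup>+z. ennreal ((norm ((deriv ^^ k) f z))\<^sup>2) \<partial>M)
      \<le> ennreal (144 * 144 ^ k * (fact k)\<^sup>2 * enn2real ?T * (bergman_norm f)\<^sup>2)"
    using carleson_embedding_nn[OF M tau hol] unfolding N
    by (subst (asm) T) (simp add: ennreal_mult[symmetric] mult.assoc)
  then show int: "integrable M (\<lambda>z. (norm ((deriv ^^ k) f z))\<^sup>2)"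
    using meas by (intro integrableI_bounded) (auto intro: le_less_trans)
  show "(LINT z|M. (norm ((deriv ^^ k) f z))\<^sup>2)
      \<le> 144 * 144 ^ k * (fact k)\<^sup>2 * enn2real ?T * (bergman_norm f)\<^sup>2"
    using le int by (subst (asm) nn_integral_eq_integral) auto
qed

section \<open>Passage to complex measures\<close>

lemma sets_positive_part: "sets (positive_part r) = sets (restrict_space borel unit_disk)"
  unfolding positive_part_def
  using sets.sigma_sets_eq[of "restrict_space borel unit_disk :: complex measure"]
    sets.space_closed[of "restrict_space borel unit_disk :: complex measure"]
  by (simp add: space_restrict_space)

text \<open>
  The set \<open>A\<close> is completed to a countable partition of \<open>E\<close> into relatively compact pieces by
  cutting the rest of \<open>E\<close> along circles that approach the unit circle.
\<close>

lemma norm_le_variation: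
  assumes E: "E \<in> sets borel" "E \<subseteq> unit_disk" and A: "A \<in> rc_borel" "A \<subseteq> E"
  shows "ennreal (norm (\<mu> A)) \<le> variation \<mu> E"
proof -
  \<comment> \<open>Taking \<open>A\<close> first makes it the first set of the disjointed sequence.\<close>
  define Q where "Q n = (case n of 0 \<Rightarrow> A | Suc m \<Rightarrow> E \<inter> cball 0 (1 - 1 / real (Suc m)))" for n :: nat
  have cball_rc: "cball 0 (1 - 1 / real (Suc m)) \<in> rc_borel" for m
  proof -
    have "cball 0 (1 - 1 / real (Suc m)) \<subseteq> unit_disk"
      by (subst cball_subset_ball_iff) simp
    then show ?thesis
      by (simp add: rc_borel_def)
  qed
  have Q: "Q n \<in> rc_borel" for n
  proof (cases n)
    case (Suc m)
    have "E \<inter> cball 0 (1 - 1 / real (Suc m)) \<in> rc_borel"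
      by (rule rc_borel_subset[OF cball_rc[of m]]) (use E(1) in auto)
    then show ?thesis by (simp add: Q_def Suc)
  qed (simp add: Q_def A(1))
  have D: "disjointed Q n \<in> rc_borel" for n
  proof (rule rc_borel_subset[OF Q[of n]])
    have "Q m \<in> sets borel" for m
      using Q[of m] by (simp add: rc_borel_def)
    then show "disjointed Q n \<in> sets borel"
      by (auto simp: disjointed_def)
  qed (rule disjointed_subset)
  have U: "(\<Union>n. disjointed Q n) = E"
  proof -
    have "x \<in> (\<Union>n. Q n)" if "x \<in> E" for x
    proof -
      have "norm x < 1" using that E by auto
      then obtain m where "1 / real (Suc m) < 1 - norm x"
        using nat_approx_posE[of "1 - norm x"] by auto
      then have "x \<in> Q (Suc m)"
        using that by (simp add: Q_def)
      then show ?thesis by blast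
    qed
    moreover have "Q n \<subseteq> E" for n
      using A by (cases n) (auto simp: Q_def)
    ultimately show ?thesis
      unfolding UN_disjointed_eq by blast
  qed
  have "ennreal (norm (\<mu> A)) = (\<Sum>i\<in>{0}. ennreal (norm (\<mu> (disjointed Q i))))"
    by (simp add: disjointed_def Q_def)
  also have "\<dots> \<le> (\<Sum>i. ennreal (norm (\<mu> (disjointed Q i))))"
    by (rule sum_le_suminf) auto
  also have "\<dots> \<le> variation \<mu> E"
    unfolding variation_def using D U disjoint_family_disjointed[of Q]
    by (intro SUP_upper) auto
  finally show ?thesis .
qed

lemma upper_variation_le_variation:
  assumes "E \<in> sets borel" "E \<subseteq> unit_disk" and "\<And>A. r A \<le> norm (\<mu> A)"
  shows "upper_variation r E \<le> variation \<mu> E"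
  unfolding upper_variation_def
  using assms by (auto intro!: SUP_least order_trans[OF ennreal_leI norm_le_variation])

lemma carleson_tau_positive_part_le:
  assumes "real_measure_on_disk r" "\<And>A. r A \<le> norm (\<mu> A)"
  shows "carleson_tau k (emeasure (positive_part r)) \<le> carleson_tau k (variation \<mu>)"
  unfolding carleson_tau_def
proof (intro SUP_subset_mono mult_right_mono order_refl)
  fix z :: complex assume "z \<in> unit_disk"
  note sub = half_ball_subset_disk[OF this]
  then show "emeasure (positive_part r) (ball z (1/2 * (1 - norm z))) \<le> variation \<mu> (ball z (1/2 * (1 - norm z)))"
    using assms by (subst emeasure_positive_part) (auto intro!: upper_variation_le_variation)
qed auto

text \<open>
  Each of the four Jordan parts is dominated by the variation. The real and the imaginary part of
  the integral are differences of two numbers between 0 and the bound for positive measures, which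
  gives \<open>288 = 2 * 144\<close>.
\<close>

lemma carleson_embedding_complex_measure:
  assumes \<mu>: "complex_measure_on_disk \<mu>" and tau: "carleson_tau k (variation \<mu>) < \<infinity>"
    and f: "f \<in> bergman_space"
  shows "cm_integrable \<mu> (\<lambda>z. (norm ((deriv ^^ k) f z))\<^sup>2)"
    and "norm (cm_integral \<mu> (\<lambda>z. (norm ((deriv ^^ k) f z))\<^sup>2))
      \<le> 288 * 144 ^ k * (fact k)\<^sup>2 * enn2real (carleson_tau k (variation \<mu>)) * (bergman_norm f)\<^sup>2"
proof -
  let ?g = "\<lambda>z. (norm ((deriv ^^ k) f z))\<^sup>2"
  define K where "K = 144 * 144 ^ k * (fact k)\<^sup>2 * enn2real (carleson_tau k (variation \<mu>)) * (bergman_norm f)\<^sup>2"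
  have part: "integrable (positive_part r) ?g \<and> 0 \<le> integral\<^sup>L (positive_part r) ?g
      \<and> integral\<^sup>L (positive_part r) ?g \<le> K"
    if r: "real_measure_on_disk r" "\<And>A. r A \<le> norm (\<mu> A)" for r
  proof -
    note le = carleson_tau_positive_part_le[OF r, of k]
    then have fin: "carleson_tau k (emeasure (positive_part r)) < \<infinity>"
      using tau by (rule le_less_trans)
    have "enn2real (carleson_tau k (emeasure (positive_part r))) \<le> enn2real (carleson_tau k (variation \<mu>))"
      using le tau by (intro enn2real_mono) auto
    then have "144 * 144 ^ k * (fact k)\<^sup>2 * enn2real (carleson_tau k (emeasure (positive_part r)))
        * (bergman_norm f)\<^sup>2 \<le> K"
      unfolding K_def by (intro mult_right_mono mult_left_mono) auto
    then show ?thesis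
      using carleson_embedding[OF sets_positive_part fin f] by (auto intro: order_trans)
  qed
  note parts = real_measure_on_disk_parts[OF \<mu>]
  note p1 = part[OF parts(1) complex_Re_le_cmod]
  have m: "- Re z \<le> norm z" "- Im z \<le> norm z" for z
    using abs_Re_le_cmod[of z] abs_Im_le_cmod[of z] by auto
  note p2 = part[OF parts(2) m(1)]
  note p3 = part[OF parts(3) order_trans[OF abs_ge_self abs_Im_le_cmod]]
  note p4 = part[OF parts(4) m(2)]
  show "cm_integrable \<mu> ?g"
    using p1 p2 p3 p4 by (simp add: cm_integrable_def jordan_parts_def)
  have "norm (cm_integral \<mu> ?g) \<le> \<bar>Re (cm_integral \<mu> ?g)\<bar> + \<bar>Im (cm_integral \<mu> ?g)\<bar>"
    by (rule cmod_le)
  also have "\<dots> \<le> K + K"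
  proof (rule add_mono)
    have diff: "\<bar>a - b\<bar> \<le> K" if "0 \<le> a \<and> a \<le> K" "0 \<le> b \<and> b \<le> K" for a b
      using that by auto
    show "\<bar>Re (cm_integral \<mu> ?g)\<bar> \<le> K"
      unfolding cm_integral_def complex.sel using p1 p2 by (intro diff) blast+
    show "\<bar>Im (cm_integral \<mu> ?g)\<bar> \<le> K"
      unfolding cm_integral_def complex.sel using p3 p4 by (intro diff) blast+
  qed
  finally show "norm (cm_integral \<mu> ?g)
      \<le> 288 * 144 ^ k * (fact k)\<^sup>2 * enn2real (carleson_tau k (variation \<mu>)) * (bergman_norm f)\<^sup>2"
    by (simp add: K_def mult_ac)
qed

section \<open>Necessity of the Carleson condition\<close>

lemma emeasure_disk_measure: "emeasure disk_measure unit_disk = 1"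
proof -
  have "emeasure disk_measure unit_disk = ennreal (1 / pi) * emeasure lborel unit_disk"
    by (simp add: disk_measure_def emeasure_restrict_space)
  also have "\<dots> = 1"
    by (simp add: emeasure_ball unit_ball_vol_2 ennreal_mult'[symmetric])
  finally show ?thesis .
qed

lemma bounded_holomorphic_in_bergman_space:
  assumes f: "f holomorphic_on unit_disk" and B: "\<And>z. z \<in> unit_disk \<Longrightarrow> norm (f z) \<le> B"
  shows "f \<in> bergman_space"
proof -
  interpret finite_measure disk_measure
    by standard (simp add: space_disk_measure emeasure_disk_measure)
  have "integrable disk_measure (\<lambda>z. (norm (f z))\<^sup>2)"
    using higher_deriv_measurable_disk[OF sets_disk_measure f, of 0] B
    by (intro integrable_const_bound[where B = "B\<^sup>2"])
       (auto simp: space_disk_measure intro!: AE_I2 power_mono)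
  then show ?thesis
    using f by (simp add: bergman_space_def)
qed

lemma carleson_constant_test:
  assumes c: "c \<in> carleson_constants k M" and f: "f \<in> bergman_space" and B: "B \<in> sets M"
    and s: "\<And>z. z \<in> B \<Longrightarrow> s \<le> (norm ((deriv ^^ k) f z))\<^sup>2"
  shows "emeasure M B * ennreal s \<le> ennreal (c * (bergman_norm f)\<^sup>2)"
proof -
  let ?g = "\<lambda>z. (norm ((deriv ^^ k) f z))\<^sup>2"
  have g: "integrable M ?g" "integral\<^sup>L M ?g \<le> c * (bergman_norm f)\<^sup>2"
    using c f by (auto simp: carleson_constants_def)
  have "emeasure M B * ennreal s = (\<integral>\<^sup>+z. ennreal s * indicator B z \<partial>M)"
    using B by (simp add: nn_integral_cmult_indicator mult.commute)
  also have "\<dots> \<le> (\<integral>\<^sup>+z. ennreal (?g z) \<partial>M)"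
    using s by (intro nn_integral_mono) (auto simp: indicator_def ennreal_leI)
  also have "\<dots> = ennreal (integral\<^sup>L M ?g)"
    using g by (intro nn_integral_eq_integral) auto
  also have "\<dots> \<le> ennreal (c * (bergman_norm f)\<^sup>2)"
    using g by (intro ennreal_leI)
  finally show ?thesis .
qed

text \<open>
  Used to test the central part of the disk: no derivative of the exponential function comes
  near zero there.
\<close>

lemma higher_deriv_exp: "(deriv ^^ k) exp = (exp :: complex \<Rightarrow> complex)"
proof (induction k)
  case (Suc k)
  have "deriv exp = (exp :: complex \<Rightarrow> complex)"
    by (rule ext, rule DERIV_imp_deriv) (rule DERIV_exp)
  then show ?case using Suc by simp
qed simp

lemma disk_kernel_denominator_ge:
  fixes a z :: complex
  assumes "norm z < 1"
  shows "1 - norm a \<le> norm (1 - a * z)"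
proof -
  have "norm (a * z) \<le> norm a"
    using assms by (simp add: norm_mult mult_left_le)
  then show ?thesis
    using norm_triangle_ineq2[of 1 "a * z"] by simp
qed

lemma higher_deriv_bergman_kernel:
  fixes a z :: complex
  assumes a: "norm a < 1" and z: "norm z < 1"
  shows "(deriv ^^ k) (\<lambda>z. 1 / (1 - a * z)\<^sup>2) z = fact (k + 1) * a ^ k / (1 - a * z) ^ (k + 2)"
  using z
proof (induction k arbitrary: z)
  case (Suc k)
  have nz: "1 - a * z \<noteq> 0"
    using disk_kernel_denominator_ge[OF Suc.prems, of a] a by auto
  have "\<forall>\<^sub>F x in nhds z. x \<in> unit_disk"
    using Suc.prems by (intro eventually_nhds_in_open) auto
  then have ev: "\<forall>\<^sub>F x in nhds z. (deriv ^^ k) (\<lambda>z. 1 / (1 - a * z)\<^sup>2) x = fact (k + 1) * a ^ k / (1 - a * x) ^ (k + 2)"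
    by eventually_elim (use Suc.IH in auto)
  have "((\<lambda>x. fact (k + 1) * a ^ k / (1 - a * x) ^ (k + 2)) has_field_derivative
      fact (k + 2) * a ^ (k + 1) / (1 - a * z) ^ (k + 3)) (at z)"
    by (rule derivative_eq_intros refl | use nz in \<open>simp; fail\<close>)+
       (use nz in \<open>simp add: divide_simps power_add power2_eq_square, simp add: algebra_simps power3_eq_cube eval_nat_numeral\<close>)
  then have "deriv (\<lambda>x. fact (k + 1) * a ^ k / (1 - a * x) ^ (k + 2)) z
      = fact (k + 2) * a ^ (k + 1) / (1 - a * z) ^ (k + 3)"
    by (rule DERIV_imp_deriv)
  then show ?case
    using deriv_cong_ev[OF ev refl] by (simp add: eval_nat_numeral)
qed (simp add: power2_eq_square)

text \<open>
  A dyadic decomposition of the range \<open>t \<ge> e\<close>. The weights \<open>1 / (2^j e)^4\<close> decay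
  faster than the areas of the disks \<open>t < 2^(j+1) e\<close> grow.
\<close>

lemma inverse_fourth_power_le_dyadic_sum:
  assumes e: "0 < e" and t: "e \<le> (t::real)"
  shows "ennreal (1 / t ^ 4) \<le> (\<Sum>j. ennreal (1 / (2 ^ j * e) ^ 4) * indicator {..<2 ^ (j + 1) * e} t)"
proof -
  define n where "n = (LEAST n. t / e < 2 ^ n)"
  have "\<exists>n. t / e < 2 ^ n"
    using real_arch_pow[of 2 "t / e"] by simp
  then have n: "t / e < 2 ^ n"
    unfolding n_def by (rule LeastI_ex)
  have "n \<noteq> 0"
    using n e t by (intro notI) (simp add: field_simps)
  then obtain j where j: "n = Suc j"
    by (cases n) auto
  have "\<not> t / e < 2 ^ j"
    using not_less_Least[of j "\<lambda>n. t / e < 2 ^ n"] j by (simp add: n_def)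
  then have lo: "2 ^ j * e \<le> t" and hi: "t < 2 ^ (j + 1) * e"
    using n j e by (simp_all add: field_simps)
  have "1 / t ^ 4 \<le> 1 / (2 ^ j * e) ^ 4"
    using lo e t by (intro divide_left_mono power_mono mult_pos_pos zero_less_power) auto
  then have "ennreal (1 / t ^ 4) \<le> (\<Sum>i\<in>{j}. ennreal (1 / (2 ^ i * e) ^ 4) * indicator {..<2 ^ (i + 1) * e} t)"
    using hi by (simp add: ennreal_leI)
  also have "\<dots> \<le> (\<Sum>j. ennreal (1 / (2 ^ j * e) ^ 4) * indicator {..<2 ^ (j + 1) * e} t)"
    by (rule sum_le_suminf) auto
  finally show ?thesis .
qed

text \<open>
  Since \<open>|1 - a z| = |a| |1/a - z|\<close>, the sublevel sets of \<open>|1 - a z|\<close> are disks about \<open>1/a\<close>, and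
  \<open>|a| \<ge> 1/2\<close> controls their radii. On the unit disk \<open>|1 - a z| \<ge> 1 - |a|\<close>, which is where the
  dyadic decomposition starts.
\<close>

lemma nn_integral_bergman_kernel_le:
  fixes a :: complex
  assumes a: "1/2 \<le> norm a" "norm a < 1"
  shows "(\<integral>\<^sup>+z\<in>unit_disk. ennreal (1 / norm (1 - a * z) ^ 4) \<partial>lborel) \<le> ennreal (64 * pi / 3 / (1 - norm a)\<^sup>2)"
proof -
  define e where "e = 1 - norm a"
  have e: "e > 0" using a by (simp add: e_def)
  have a0: "a \<noteq> 0" using a by auto
  define B where "B j = ball (1 / a) (2 ^ (j + 2) * e)" for j :: nat
  have "(\<integral>\<^sup>+z\<in>unit_disk. ennreal (1 / norm (1 - a * z) ^ 4) \<partial>lborel)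
      \<le> (\<integral>\<^sup>+z. (\<Sum>j. ennreal (1 / (2 ^ j * e) ^ 4) * indicator (B j) z) \<partial>lborel)"
  proof (rule nn_integral_mono)
    fix z :: complex
    show "ennreal (1 / norm (1 - a * z) ^ 4) * indicator unit_disk z
        \<le> (\<Sum>j. ennreal (1 / (2 ^ j * e) ^ 4) * indicator (B j) z)"
    proof (cases "z \<in> unit_disk")
      case True
      have "z \<in> B j" if "norm (1 - a * z) < 2 ^ (j + 1) * e" for j
      proof -
        have "norm (1 / a - z) * norm a = norm (1 - a * z)"
          using a0 by (simp add: norm_mult[symmetric] algebra_simps)
        moreover have "norm (1 / a - z) * (1/2) \<le> norm (1 / a - z) * norm a"
          using a by (intro mult_left_mono) auto
        ultimately have "norm (1 / a - z) < 2 * (2 ^ (j + 1) * e)"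
          using that by linarith
        then show ?thesis by (simp add: B_def dist_norm)
      qed
      then have ind: "indicator {..<2 ^ (j + 1) * e} (norm (1 - a * z)) \<le> (indicator (B j) z :: ennreal)" for j
        by (auto simp: indicator_def)
      have "ennreal (1 / norm (1 - a * z) ^ 4)
          \<le> (\<Sum>j. ennreal (1 / (2 ^ j * e) ^ 4) * indicator {..<2 ^ (j + 1) * e} (norm (1 - a * z)))"
        using True e disk_kernel_denominator_ge[of z a]
        by (intro inverse_fourth_power_le_dyadic_sum) (auto simp: e_def)
      also have "\<dots> \<le> (\<Sum>j. ennreal (1 / (2 ^ j * e) ^ 4) * indicator (B j) z)"
        by (intro suminf_le mult_left_mono ind) auto
      finally show ?thesis using True by simp
    qed simp
  qed
  also have "\<dots> = (\<Sum>j. \<integral>\<^sup>+z. ennreal (1 / (2 ^ j * e) ^ 4) * indicator (B j) z \<partial>lborel)"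
    by (intro nn_integral_suminf borel_measurable_times_ennreal borel_measurable_indicator) (auto simp: B_def)
  also have "\<dots> = (\<Sum>j. ennreal (16 * pi / e\<^sup>2 * (1 / 4) ^ j))"
  proof (rule suminf_cong)
    fix j :: nat
    have "(\<integral>\<^sup>+z. ennreal (1 / (2 ^ j * e) ^ 4) * indicator (B j) z \<partial>lborel)
        = ennreal (1 / (2 ^ j * e) ^ 4) * emeasure lborel (B j)"
      by (intro nn_integral_cmult_indicator) (simp add: B_def)
    also have "\<dots> = ennreal (1 / (2 ^ j * e) ^ 4 * (pi * (2 ^ (j + 2) * e)\<^sup>2))"
    proof -
      have "emeasure lborel (B j) = ennreal (pi * (2 ^ (j + 2) * e)\<^sup>2)"
        using e by (simp add: B_def emeasure_ball unit_ball_vol_2)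
      then show ?thesis
        using e by (simp only:) (intro ennreal_mult[symmetric], auto)
    qed
    also have "1 / (2 ^ j * e) ^ 4 * (pi * (2 ^ (j + 2) * e)\<^sup>2) = 16 * pi / e\<^sup>2 * (1 / 4) ^ j"
    proof -
      have "(4::real) ^ j = 2 ^ j * 2 ^ j"
        by (simp add: power_mult_distrib[symmetric])
      then show ?thesis
        using e by (simp add: power_divide field_simps eval_nat_numeral)
    qed
    finally show "(\<integral>\<^sup>+z. ennreal (1 / (2 ^ j * e) ^ 4) * indicator (B j) z \<partial>lborel)
        = ennreal (16 * pi / e\<^sup>2 * (1 / 4) ^ j)" .
  qed
  also have "\<dots> = ennreal (16 * pi / e\<^sup>2 * (1 / (1 - 1 / 4)))"
    using e by (intro suminf_ennreal_eq sums_mult geometric_sums) auto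
  finally show ?thesis
    by (simp add: e_def mult.commute)
qed

lemma bergman_kernel_norm_le:
  fixes a :: complex
  assumes a: "1/2 \<le> norm a" "norm a < 1"
  shows "(\<lambda>z. 1 / (1 - a * z)\<^sup>2) \<in> bergman_space"
    and "(bergman_norm (\<lambda>z. 1 / (1 - a * z)\<^sup>2))\<^sup>2 \<le> 22 / (1 - norm a)\<^sup>2"
proof -
  let ?f = "\<lambda>z. 1 / (1 - a * z)\<^sup>2"
  have e: "1 - norm a > 0" using a by simp
  have nz: "1 - a * z \<noteq> 0" if "z \<in> unit_disk" for z
    using disk_kernel_denominator_ge[of z a] that e by auto
  have hol: "?f holomorphic_on unit_disk"
    using nz by (intro holomorphic_intros) auto
  show f: "?f \<in> bergman_space"
  proof (rule bounded_holomorphic_in_bergman_space[OF hol])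
    fix z assume "z \<in> unit_disk"
    then have "(1 - norm a)\<^sup>2 \<le> (norm (1 - a * z))\<^sup>2"
      using disk_kernel_denominator_ge[of z a] e by (intro power_mono) auto
    then show "norm (?f z) \<le> 1 / (1 - norm a)\<^sup>2"
      using e by (simp add: norm_divide norm_power frac_le)
  qed
  have sq: "(norm (?f z))\<^sup>2 = 1 / norm (1 - a * z) ^ 4" for z
    by (simp add: norm_divide norm_power power_divide power_mult[symmetric])
  have "ennreal ((bergman_norm ?f)\<^sup>2)
      = ennreal (1 / pi) * (\<integral>\<^sup>+z\<in>unit_disk. ennreal (1 / norm (1 - a * z) ^ 4) \<partial>lborel)"
    unfolding bergman_norm_sq[OF f] sq[symmetric]
    using higher_deriv_measurable_disk[OF sets_disk_measure hol, of 0]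
    by (intro nn_integral_disk_measure) simp
  also have "\<dots> \<le> ennreal (1 / pi) * ennreal (64 * pi / 3 / (1 - norm a)\<^sup>2)"
    by (intro mult_left_mono nn_integral_bergman_kernel_le a) auto
  also have "\<dots> = ennreal (64 / 3 / (1 - norm a)\<^sup>2)"
    by (simp add: ennreal_mult'[symmetric])
  finally have "(bergman_norm ?f)\<^sup>2 \<le> 64 / 3 / (1 - norm a)\<^sup>2"
    by simp
  also have "\<dots> \<le> 22 / (1 - norm a)\<^sup>2"
    by (intro divide_right_mono) auto
  finally show "(bergman_norm ?f)\<^sup>2 \<le> 22 / (1 - norm a)\<^sup>2" .
qed

text \<open>
  A disk of the condition with centre \<open>w\<close> is tested with the exponential function if
  \<open>|w| < 1/2\<close>. Otherwise it is tested with the Bergman kernel \<open>1 / (1 - cnj w * z)\<^sup>2\<close>, whose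
  \<open>k\<close>-th derivative has size at least a constant times \<open>(1 - |w|)^(- k - 2)\<close> on that disk while
  its norm is at most a constant times \<open>(1 - |w|)\<^sup>-\<^sup>1\<close>. The kernel alone would not do, because
  its derivatives of positive order vanish for \<open>w = 0\<close>.
\<close>

lemma carleson_tau_finite:
  fixes M :: "complex measure"
  assumes M: "sets M = sets (restrict_space borel unit_disk)" and c: "c \<in> carleson_constants k M"
  shows "carleson_tau k (emeasure M) < \<infinity>"
proof -
  have exp_in: "exp \<in> bergman_space"
  proof (rule bounded_holomorphic_in_bergman_space[where B = "exp 1"])
    fix z :: complex assume "z \<in> unit_disk"
    then show "norm (exp z) \<le> exp 1"
      using complex_Re_le_cmod[of z] by simp
  qed (intro holomorphic_intros)
  \<comment> \<open>Bounds from the central disks and from the outer disks.\<close>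
  define J1 where "J1 = max 0 (c * (bergman_norm exp)\<^sup>2) * exp 2 * 4 ^ (k + 1)"
  define J2 where "J2 = max 0 c * 22 * 4 ^ k * 9 ^ (k + 2)"
  have "emeasure M (ball w (1/2 * (1 - norm w))) * ennreal ((1 - norm w) powi (- 2 * (int k + 1)))
      \<le> ennreal (J1 + J2)" if w: "w \<in> unit_disk" for w
  proof -
    define e where "e = 1 - norm w"
    have e: "e > 0" using w by (simp add: e_def)
    define B where "B = ball w (1/2 * (1 - norm w))"
    have Bsub: "B \<subseteq> unit_disk"
      unfolding B_def by (rule half_ball_subset_disk[OF w])
    then have B: "B \<in> sets M"
      by (auto simp: M sets_restrict_space_iff B_def)
    have "emeasure M B * ennreal (1 / e ^ (2 * k + 2)) \<le> ennreal (J1 + J2)"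
    proof (cases "norm w < 1/2")
      case True
      have "exp (- 2) \<le> (norm ((deriv ^^ k) exp z))\<^sup>2" if "z \<in> B" for z :: complex
      proof -
        have "- 1 \<le> Re z"
          using that Bsub abs_Re_le_cmod[of z] by force
        then have "exp (- 2) \<le> exp (2 * Re z)" by simp
        also have "\<dots> = (norm ((deriv ^^ k) exp z))\<^sup>2"
          by (simp add: higher_deriv_exp exp_double)
        finally show ?thesis .
      qed
      then have test: "emeasure M B * ennreal (exp (- 2)) \<le> ennreal (c * (bergman_norm exp)\<^sup>2)"
        by (rule carleson_constant_test[OF c exp_in B])
      have "1 \<le> (2 * e) ^ (2 * k + 2)"
        using True by (intro one_le_power) (simp add: e_def)
      also have "\<dots> = 4 ^ (k + 1) * e ^ (2 * k + 2)"
        by (rule double_even_power)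
      finally have "1 / e ^ (2 * k + 2) \<le> exp (- 2) * (exp 2 * 4 ^ (k + 1))"
        using e by (simp add: field_simps exp_minus)
      then have "emeasure M B * ennreal (1 / e ^ (2 * k + 2))
          \<le> emeasure M B * ennreal (exp (- 2) * (exp 2 * 4 ^ (k + 1)))"
        by (intro mult_left_mono ennreal_leI) auto
      also have "\<dots> = (emeasure M B * ennreal (exp (- 2))) * ennreal (exp 2 * 4 ^ (k + 1))"
        by (subst ennreal_mult) (auto simp: mult.assoc)
      also have "\<dots> \<le> ennreal (max 0 (c * (bergman_norm exp)\<^sup>2)) * ennreal (exp 2 * 4 ^ (k + 1))"
        by (intro mult_right_mono order_trans[OF test] ennreal_leI) auto
      also have "\<dots> = ennreal J1"
        by (simp add: J1_def ennreal_mult[symmetric] mult.assoc)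
      also have "\<dots> \<le> ennreal (J1 + J2)"
        by (intro ennreal_leI) (simp add: J2_def)
      finally show ?thesis .
    next
      case False
      define a where "a = cnj w"
      have a: "1/2 \<le> norm a" "norm a < 1"
        using False w by (simp_all add: a_def)
      have ea: "1 - norm a = e"
        by (simp add: a_def e_def)
      let ?f = "\<lambda>z. 1 / (1 - a * z)\<^sup>2"
      let ?s = "1 / (4 ^ k * 9 ^ (k + 2) * e ^ (2 * k + 4))"
      have "?s \<le> (norm ((deriv ^^ k) ?f z))\<^sup>2" if z: "z \<in> B" for z
      proof -
        have z1: "norm z < 1" using z Bsub by auto
        have den: "0 < norm (1 - a * z)"
          using disk_kernel_denominator_ge[OF z1, of a] e ea by linarith
        have "1 - a * z = of_real (1 - (norm w)\<^sup>2) + a * (w - z)"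
          by (simp add: a_def algebra_simps complex_norm_square del: of_real_power)
        then have "norm (1 - a * z) \<le> \<bar>1 - (norm w)\<^sup>2\<bar> + norm a * norm (w - z)"
          by (metis norm_mult norm_of_real norm_triangle_ineq)
        also have "\<bar>1 - (norm w)\<^sup>2\<bar> = e * (1 + norm w)"
          using w by (simp add: e_def algebra_simps power2_eq_square abs_square_le_1 mult_le_one)
        \<comment> \<open>The centre contributes \<open>1 - |w|\<^sup>2 \<le> 2e\<close>, the displacement \<open>z - w\<close> at most \<open>e/2 \<le> e\<close>.\<close>
        also have "e * (1 + norm w) + norm a * norm (w - z) \<le> e * 2 + 1 * e"
          using w z a e by (intro add_mono mult_mono) (auto simp: B_def e_def dist_norm)
        finally have den3: "norm (1 - a * z) \<le> 3 * e" by simp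
        have "4 ^ k * 9 ^ (k + 2) * e ^ (2 * k + 4) = ((3 * e) ^ (k + 2) * 2 ^ k)\<^sup>2"
          using power_mult_distrib[of 2 "2::real" k] power_mult_distrib[of 3 "3::real" k]
          by (simp add: power_mult_distrib power2_eq_square power_add eval_nat_numeral power_mult algebra_simps)
        then have "?s = ((1/2) ^ k / (3 * e) ^ (k + 2))\<^sup>2"
          by (simp add: power_divide mult.commute)
        also have "\<dots> \<le> (fact (k + 1) * norm a ^ k / norm (1 - a * z) ^ (k + 2))\<^sup>2"
        proof (intro power_mono frac_le)
          have "(1/2) ^ k \<le> norm a ^ k"
            using a by (intro power_mono) auto
          also have "\<dots> \<le> fact (k + 1) * norm a ^ k"
            using fact_ge_1[of "k + 1", where 'a = real] by (intro mult_le_cancel_right1[THEN iffD2]) auto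
          finally show "(1/2) ^ k \<le> fact (k + 1) * norm a ^ k" .
        qed (use den den3 e in auto)
        also have "\<dots> = (norm ((deriv ^^ k) ?f z))\<^sup>2"
          unfolding higher_deriv_bergman_kernel[OF a(2) z1]
          by (simp add: norm_mult norm_divide norm_power norm_fact del: fact_Suc)
        finally show ?thesis .
      qed
      then have test: "emeasure M B * ennreal ?s \<le> ennreal (c * (bergman_norm ?f)\<^sup>2)"
        by (rule carleson_constant_test[OF c bergman_kernel_norm_le(1)[OF a] B])
      have "c * (bergman_norm ?f)\<^sup>2 \<le> max 0 c * (22 / e\<^sup>2)"
        using bergman_kernel_norm_le(2)[OF a] unfolding ea by (intro mult_mono) auto
      note test = order_trans[OF test ennreal_leI[OF this]]
      have "1 / e ^ (2 * k + 2) = ?s * (4 ^ k * 9 ^ (k + 2) * e\<^sup>2)"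
        using e by (simp add: field_simps power_add eval_nat_numeral)
      then have "emeasure M B * ennreal (1 / e ^ (2 * k + 2))
          = (emeasure M B * ennreal ?s) * ennreal (4 ^ k * 9 ^ (k + 2) * e\<^sup>2)"
        using e by (simp only: mult.assoc ennreal_mult[symmetric]) (simp add: ennreal_mult[symmetric] mult.assoc)
      also have "\<dots> \<le> ennreal (max 0 c * (22 / e\<^sup>2)) * ennreal (4 ^ k * 9 ^ (k + 2) * e\<^sup>2)"
        by (intro mult_right_mono test) auto
      also have "\<dots> = ennreal J2"
        using e by (simp add: J2_def ennreal_mult[symmetric] field_simps)
      also have "\<dots> \<le> ennreal (J1 + J2)"
        by (intro ennreal_leI) (simp add: J1_def)
      finally show ?thesis .
    qed
    then show ?thesis
      by (simp only: carleson_weight B_def e_def)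
  qed
  then have "carleson_tau k (emeasure M) \<le> ennreal (J1 + J2)"
    unfolding carleson_tau_def by (intro SUP_least) auto
  then show ?thesis
    by (rule le_less_trans) simp
qed

section \<open>The smallest constant\<close>

lemma bergman_norm_one: "(\<lambda>_. 1) \<in> bergman_space" "bergman_norm (\<lambda>_. 1) = 1"
proof -
  show "(\<lambda>_. 1) \<in> bergman_space"
    by (rule bounded_holomorphic_in_bergman_space[where B = 1]) auto
  show "bergman_norm (\<lambda>_. 1) = 1"
    using emeasure_disk_measure
    by (simp add: bergman_norm_def measure_def space_disk_measure)
qed

text \<open>
  The defining inequalities are closed conditions on the constant, and the constant function 1
  bounds all admissible constants from below by 0.
\<close>

lemma smallest_carleson_constant:
  assumes ne: "carleson_constants k M \<noteq> {}"
  shows "Inf (carleson_constants k M) \<in> carleson_constants k M"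
    and "\<And>c. c \<in> carleson_constants k M \<Longrightarrow> Inf (carleson_constants k M) \<le> c"
proof -
  let ?S = "carleson_constants k M"
  let ?I = "\<lambda>f. LINT z|M. (norm ((deriv ^^ k) f z))\<^sup>2"
  have S: "integrable M (\<lambda>z. (norm ((deriv ^^ k) f z))\<^sup>2)" "\<bar>?I f\<bar> \<le> c * (bergman_norm f)\<^sup>2"
    if "c \<in> ?S" "f \<in> bergman_space" for c f
    using that by (auto simp: carleson_constants_def)
  have "0 \<le> c" if "c \<in> ?S" for c
    using order_trans[OF abs_ge_zero S(2)[OF that bergman_norm_one(1)]]
    by (simp add: bergman_norm_one(2))
  then have bdd: "bdd_below ?S" by (intro bdd_belowI)
  then show "\<And>c. c \<in> ?S \<Longrightarrow> Inf ?S \<le> c"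
    by (rule cInf_lower[rotated])
  have "\<bar>?I f\<bar> \<le> Inf ?S * (bergman_norm f)\<^sup>2" if f: "f \<in> bergman_space" for f
  proof (cases "(bergman_norm f)\<^sup>2 = 0")
    case True
    then show ?thesis using ne S(2)[OF _ f] by fastforce
  next
    case False
    then have pos: "0 < (bergman_norm f)\<^sup>2" by simp
    have "\<bar>?I f\<bar> / (bergman_norm f)\<^sup>2 \<le> Inf ?S"
      using S(2)[OF _ f] pos by (intro cInf_greatest ne) (simp add: pos_divide_le_eq)
    then show ?thesis using pos by (simp add: pos_divide_le_eq)
  qed
  moreover have "integrable M (\<lambda>z. (norm ((deriv ^^ k) f z))\<^sup>2)" if "f \<in> bergman_space" for f
    using ne S(1)[OF _ that] by blast
  moreover have "m \<in> ?S"
    if "\<And>f. f \<in> bergman_space \<Longrightarrow> \<bar>?I f\<bar> \<le> m * (bergman_norm f)\<^sup>2"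
      and "\<And>f. f \<in> bergman_space \<Longrightarrow> integrable M (\<lambda>z. (norm ((deriv ^^ k) f z))\<^sup>2)" for m
    unfolding carleson_constants_def using that by blast
  ultimately show "Inf ?S \<in> ?S"
    by blast
qed

theorem theorem6p3:
  shows "\<exists>C p :: real. C > 0 \<and> 0 < p \<and> p < 1 \<and> (\<forall>k :: nat.
    (\<forall>\<mu> :: complex set \<Rightarrow> complex.
       complex_measure_on_disk \<mu> \<and> locally_finite \<mu> \<and> carleson_tau k (variation \<mu>) < \<infinity> \<longrightarrow>
       (\<forall>f \<in> bergman_space.
          cm_integrable \<mu> (\<lambda>z. (norm ((deriv ^^ k) f z))\<^sup>2) \<and>
          norm (cm_integral \<mu> (\<lambda>z. (norm ((deriv ^^ k) f z))\<^sup>2))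
            \<le> C * p powi (- 2 * int k) * (fact k)\<^sup>2 * enn2real (carleson_tau k (variation \<mu>))
               * (bergman_norm f)\<^sup>2))
    \<and>
    (\<forall>\<mu> :: complex measure.
       sets \<mu> = sets (restrict_space borel unit_disk) \<and> carleson_constants k \<mu> \<noteq> {} \<longrightarrow>
       carleson_tau k (emeasure \<mu>) < \<infinity> \<and>
       (\<exists>c \<in> carleson_constants k \<mu>. (\<forall>c' \<in> carleson_constants k \<mu>. c \<le> c') \<and>
          c \<le> C * p powi (- 2 * int k) * (fact k)\<^sup>2 * enn2real (carleson_tau k (emeasure \<mu>)))))"
proof -
  have p: "(1/12 :: real) powi (- 2 * int k) = 144 ^ k" for k
  proof -
    have "- 2 * int k = - int (2 * k)" by simp
    then have "(1/12 :: real) powi (- 2 * int k) = inverse ((1/12) ^ (2 * k))"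
      by (simp only: power_int_minus power_int_of_nat)
    also have "\<dots> = 144 ^ k"
      by (simp add: power_mult power_one_over power2_eq_square)
    finally show ?thesis .
  qed
  have direct: "cm_integrable \<mu> (\<lambda>z. (norm ((deriv ^^ k) f z))\<^sup>2) \<and>
      norm (cm_integral \<mu> (\<lambda>z. (norm ((deriv ^^ k) f z))\<^sup>2))
        \<le> 288 * (1/12) powi (- 2 * int k) * (fact k)\<^sup>2 * enn2real (carleson_tau k (variation \<mu>))
           * (bergman_norm f)\<^sup>2"
    if "complex_measure_on_disk \<mu>" "carleson_tau k (variation \<mu>) < \<infinity>" "f \<in> bergman_space" for k \<mu> f
    using carleson_embedding_complex_measure[OF that] by (simp only: p)
  have converse: "carleson_tau k (emeasure \<mu>) < \<infinity> \<and>
      (\<exists>c \<in> carleson_constants k \<mu>. (\<forall>c' \<in> carleson_constants k \<mu>. c \<le> c') \<and>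
         c \<le> 288 * (1/12) powi (- 2 * int k) * (fact k)\<^sup>2 * enn2real (carleson_tau k (emeasure \<mu>)))"
    if M: "sets \<mu> = sets (restrict_space borel unit_disk)" and ne: "carleson_constants k \<mu> \<noteq> {}" for k \<mu>
  proof
    show tau: "carleson_tau k (emeasure \<mu>) < \<infinity>"
      using ne carleson_tau_finite[OF M] by blast
    let ?K = "144 * 144 ^ k * (fact k)\<^sup>2 * enn2real (carleson_tau k (emeasure \<mu>))"
    have "?K \<in> carleson_constants k \<mu>"
      using carleson_embedding[OF M tau] by (simp add: carleson_constants_def)
    then have "Inf (carleson_constants k \<mu>) \<le> ?K"
      by (rule smallest_carleson_constant(2)[OF ne])
    also have "\<dots> \<le> 288 * (1/12) powi (- 2 * int k) * (fact k)\<^sup>2 * enn2real (carleson_tau k (emeasure \<mu>))"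
      unfolding p by (intro mult_right_mono) auto
    finally show "\<exists>c \<in> carleson_constants k \<mu>. (\<forall>c' \<in> carleson_constants k \<mu>. c \<le> c') \<and>
        c \<le> 288 * (1/12) powi (- 2 * int k) * (fact k)\<^sup>2 * enn2real (carleson_tau k (emeasure \<mu>))"
      using smallest_carleson_constant[OF ne] by (intro bexI[of _ "Inf (carleson_constants k \<mu>)"]) auto
  qed
  show ?thesis
  proof (rule exI[of _ 288], rule exI[of _ "1/12"], intro conjI allI)
    fix k and \<mu> :: "complex set \<Rightarrow> complex"
    show "complex_measure_on_disk \<mu> \<and> locally_finite \<mu> \<and> carleson_tau k (variation \<mu>) < \<infinity> \<longrightarrow>
       (\<forall>f \<in> bergman_space.
          cm_integrable \<mu> (\<lambda>z. (norm ((deriv ^^ k) f z))\<^sup>2) \<and>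
          norm (cm_integral \<mu> (\<lambda>z. (norm ((deriv ^^ k) f z))\<^sup>2))
            \<le> 288 * (1/12) powi (- 2 * int k) * (fact k)\<^sup>2 * enn2real (carleson_tau k (variation \<mu>))
               * (bergman_norm f)\<^sup>2)"
      using direct by blast
  next
    fix k and \<mu> :: "complex measure"
    show "sets \<mu> = sets (restrict_space borel unit_disk) \<and> carleson_constants k \<mu> \<noteq> {} \<longrightarrow>
       carleson_tau k (emeasure \<mu>) < \<infinity> \<and>
       (\<exists>c \<in> carleson_constants k \<mu>. (\<forall>c' \<in> carleson_constants k \<mu>. c \<le> c') \<and>
          c \<le> 288 * (1/12) powi (- 2 * int k) * (fact k)\<^sup>2 * enn2real (carleson_tau k (emeasure \<mu>)))"
      using converse by blast
  qed simp_all
qed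

end
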